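(* Let $\varphi\colon \mathbb{N}\to \mathbb{R}_{+}$ be a non-decreasing function, and let $$\mathcal{F}_2(\varphi)=\Big\{x\in[0,1)\colon \exists\, 1\le k\neq l \le n \text{ with } a_{k}(x)a_{k+1}(x)\ge \varphi(n) \text{ and } a_{l}(x)a_{l+1}(x)\ge \varphi(n), \text{ for infinitely many } n\in \mathbb{N}\Big\}.$$ Then $$\mathcal{L}\big(\mathcal{F}_2(\varphi)\big)=\begin{cases} 0, & \text{if } \displaystyle\sum_{n=1}^{\infty}\frac{\varphi(n)+n\log^{2} \varphi(n)}{\varphi(n)^{2}}<\infty;\\[2mm] 1, & \text{if } \displaystyle\sum_{n=1}^{\infty}\frac{\varphi(n)+n\log^{2} \varphi(n)}{\varphi(n)^{2}}=\infty.\end{cases}$$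
   Context: For an irrational $x\in[0,1)$, $x=[a_1(x),a_2(x),\ldots]=\cfrac{1}{a_1(x)+\cfrac{1}{a_2(x)+\cdots}}$ denotes its simple infinite continued fraction expansion with partial quotients $a_n(x)\in\mathbb{N}=\{1,2,\ldots\}$; equivalently $a_n(x)=\lfloor 1/T^{n-1}(x)\rfloor$, where $T\colon[0,1)\to[0,1)$ is the Gauss map $T(0)=0$, $T(x)=1/x \pmod 1$ for $x\in(0,1)$. (Rational numbers form a countable set and play no role.) $\mathbb{R}_+$ denotes the positive reals, $\mathcal{L}$ is Lebesgue measure, and $\log^2 y=(\log y)^2$. The condition in $\mathcal{F}_2(\varphi)$ means: for infinitely many $n$ there exist distinct $k,l\in\{1,\ldots,n\}$ (depending on $n$) with both inequalities. *)

theory Defs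
  imports "HOL-Analysis.Analysis"
begin

definition gauss_map :: "real \<Rightarrow> real" where
  "gauss_map x = (if x = 0 then 0 else frac (1 / x))"

text \<open>The partial quotient \<open>a\<^sub>n(x)\<close> of the continued fraction expansion of an irrational
  \<open>x\<close> in \<open>[0,1)\<close>. Indices start at \<open>n = 1\<close>; the value at \<open>n = 0\<close> and the values at rational
  \<open>x\<close> carry no meaning.\<close>
definition partial_quotient :: "nat \<Rightarrow> real \<Rightarrow> nat" where
  "partial_quotient n x = nat \<lfloor>1 / (gauss_map ^^ (n - 1)) x\<rfloor>"

text \<open>Rational points, whose expansion is finite, are excluded. As \<open>k\<close> ranges over
  \<open>{1..n}\<close>, the index \<open>n = 0\<close> never satisfies the condition.\<close>
definition F2 :: "(nat \<Rightarrow> real) \<Rightarrow> real set" where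
  "F2 \<phi> = {x \<in> {0..<1} - \<rat>. \<exists>\<^sub>\<infinity>n. \<exists>k\<in>{1..n}. \<exists>l\<in>{1..n}. k \<noteq> l \<and>
      real (partial_quotient k x * partial_quotient (k + 1) x) \<ge> \<phi> n \<and>
      real (partial_quotient l x * partial_quotient (l + 1) x) \<ge> \<phi> n}"

end

theory Submission
  imports Defs
begin

text \<open>
  Given the first \<open>m\<close> partial quotients, the law of \<open>T\<^sup>m x\<close> belongs to the one-parameter family of
  densities \<open>(1 + s) / (1 + s t)\<^sup>2\<close>, \<open>s \<in> [0,1]\<close>. A bound that holds for an event under every member
  of the family therefore holds conditionally on any past, and in place of mixing one can multiply
  such bounds.

  Uniformly in \<open>s\<close>, the event \<open>a\<^sub>1 \<ge> y\<close> has probability of order \<open>1 / y\<close>, the event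
  \<open>a\<^sub>1 a\<^sub>2 \<ge> y\<close> of order \<open>log y / y\<close>, and the event that both \<open>a\<^sub>1 a\<^sub>2\<close> and \<open>a\<^sub>2 a\<^sub>3\<close> are at least \<open>y\<close>
  again of order \<open>1 / y\<close>. If the series converges, then \<open>\<phi>\<close> tends to infinity, and by monotonicity one
  may take the larger index of the pair to be \<open>n\<close> itself; adjacent indices contribute \<open>1 / \<phi>(n)\<close>
  and separated ones \<open>n (log \<phi>(n) / \<phi>(n))\<^sup>2\<close>, so Borel-Cantelli applies.

  If the series of \<open>1 / \<phi>(n)\<close> diverges, then almost surely \<open>a\<^sub>n \<ge> \<phi>(n)\<close> infinitely often, and a
  single large digit makes two adjacent products large. Otherwise the series of
  \<open>n (log \<phi>(n) / \<phi>(n))\<^sup>2\<close> diverges. Among consecutive blocks of \<open>2\<^sup>j\<close> digits, each half-block contains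
  a product exceeding \<open>\<phi>(2\<^bsup>j+1\<^esup>)\<close> with conditional probability at least \<open>x / (1 + x)\<close>, where \<open>x\<close> is of
  order \<open>2\<^sup>j log \<phi>(2\<^bsup>j+1\<^esup>) / \<phi>(2\<^bsup>j+1\<^esup>)\<close>. The squares of these bounds have divergent sum, so almost
  surely infinitely many blocks contain two such products.
\<close>

subsection \<open>Conditional laws of the Gauss orbit\<close>

text \<open>Conditioned on its first \<open>m\<close> partial quotients, \<open>T\<^sup>m x\<close> has density
  \<open>(1 + s) / (1 + s t)\<^sup>2\<close> on the unit interval, where \<open>s = q\<^bsub>m-1\<^esub> / q\<^sub>m\<close> is the ratio of the
  last two convergent denominators.\<close>
definition cyl_dens :: "real \<Rightarrow> real \<Rightarrow> real" where
  "cyl_dens s x = (1 + s) / (1 + s * x)\<^sup>2"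

definition cyl_law :: "real \<Rightarrow> real measure" where
  "cyl_law s = density lborel (\<lambda>x. ennreal (cyl_dens s x * indicator {0<..<1} x))"

text \<open>The mass that \<open>cyl_law s\<close> gives to the points whose first digit is
  \<open>a\<close>; see \<open>pr_digit_eq\<close>.\<close>

definition digit_prob :: "real \<Rightarrow> nat \<Rightarrow> real" where
  "digit_prob s a = (1 + s) / ((a + s) * (a + s + 1))"

lemma cyl_dens_measurable [measurable]: "cyl_dens s \<in> borel_measurable borel"
  unfolding cyl_dens_def by measurable

lemma cyl_dens_nonneg: "s \<ge> 0 \<Longrightarrow> cyl_dens s x \<ge> 0"
  by (simp add: cyl_dens_def)

lemma sets_cyl_law [simp, measurable_cong]: "sets (cyl_law s) = sets borel"
  and space_cyl_law [simp]: "space (cyl_law s) = UNIV"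
  by (simp_all add: cyl_law_def)

lemma emeasure_cyl_law:
  assumes "A \<in> sets borel"
  shows "emeasure (cyl_law s) A =
    (\<integral>\<^sup>+x. ennreal (cyl_dens s x * indicator A x * indicator {0<..<1} x) \<partial>lborel)"
  unfolding cyl_law_def using assms
  by (subst emeasure_density) (auto intro!: nn_integral_cong split: split_indicator)

lemma AE_cyl_law: "AE x in cyl_law s. x \<in> {0<..<1}"
proof -
  have "AE x in lborel. 0 < ennreal (cyl_dens s x * indicator {0<..<1} x) \<longrightarrow> x \<in> {0<..<1::real}"
    by (rule AE_I2) (auto simp: indicator_def split: if_splits)
  then show ?thesis unfolding cyl_law_def by (subst AE_density) measurable
qed

lemma emeasure_cyl_law_cong:
  assumes "A \<inter> {0<..<1} = B \<inter> {0<..<1}" "A \<in> sets borel" "B \<in> sets borel"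
  shows "emeasure (cyl_law s) A = emeasure (cyl_law s) B"
proof (rule emeasure_eq_AE)
  show "AE x in cyl_law s. (x \<in> A) = (x \<in> B)"
    using AE_cyl_law[of s] by (rule eventually_mono) (use assms(1) in blast)
qed (use assms in simp_all)

text \<open>The Moebius map \<open>(1 + s) * x / (1 + s * x)\<close> is an antiderivative of the
  density and vanishes at 0. The digit probabilities below are computed from this distribution
  function.\<close>

lemma emeasure_cyl_law_initial:
  assumes s: "s \<in> {0..1}" and c: "c \<in> {0..1}"
  shows "emeasure (cyl_law s) {0<..<c} = ennreal ((1 + s) * c / (1 + s * c))"
proof -
  have "emeasure (cyl_law s) {0<..<c} = (\<integral>\<^sup>+x. ennreal (cyl_dens s x) * indicator {0..c} x \<partial>lborel)"
    unfolding emeasure_cyl_law[OF borel_open[OF open_greaterThanLessThan]]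
  proof (rule nn_integral_cong_AE)
    show "AE x in lborel. ennreal (cyl_dens s x * indicator {0<..<c} x * indicator {0<..<1} x) =
      ennreal (cyl_dens s x) * indicator {0..c} x"
      using AE_lborel_singleton[of 0] AE_lborel_singleton[of c]
      by eventually_elim (use c in \<open>auto split: split_indicator\<close>)
  qed
  also have "\<dots> = ennreal ((1 + s) * c / (1 + s * c) - (1 + s) * 0 / (1 + s * 0))"
  proof (rule nn_integral_FTC_Icc)
    fix x assume "x \<in> {0..c}"
    then have "1 + s * x \<noteq> 0" using s by (auto simp: add_nonneg_eq_0_iff)
    then show "DERIV (\<lambda>x. (1 + s) * x / (1 + s * x)) x :> cyl_dens s x"
      unfolding cyl_dens_def
      by (auto intro!: derivative_eq_intros simp: power2_eq_square field_simps)
  qed (use s c in \<open>auto intro: cyl_dens_nonneg\<close>)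
  finally show ?thesis by simp
qed

lemma emeasure_cyl_law_UNIV:
  assumes "s \<in> {0..1}"
  shows "emeasure (cyl_law s) UNIV = 1"
proof -
  have "emeasure (cyl_law s) UNIV = emeasure (cyl_law s) {0<..<1}"
    by (rule emeasure_cyl_law_cong) auto
  also have "\<dots> = 1" using emeasure_cyl_law_initial[OF assms, of 1] assms by simp
  finally show ?thesis .
qed

text \<open>If the next digit is a, the ratio s = q_(m-1) / q_m turns into q_m / q_(m+1) = 1 / (a +
  s). The parameter thus stays in the unit interval.\<close>

lemma next_state: "s \<in> {0..1} \<Longrightarrow> 1 / (real (Suc i) + s) \<in> {0..1}"
  by auto

lemma digit_prob_nonneg: "s \<in> {0..1} \<Longrightarrow> 0 \<le> digit_prob s a"
  by (auto simp: digit_prob_def)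

lemma shift_measurable:
  fixes A :: "real set"
  assumes "A \<in> sets borel"
  shows "{t. 1 / (c + t) \<in> A} \<in> sets borel"
proof -
  have "(\<lambda>t. 1 / (c + t)) -` A \<inter> space borel \<in> sets borel"
    using assms by (intro measurable_sets[of _ borel borel]) auto
  then show ?thesis by (simp add: vimage_def)
qed

text \<open>The inverse branch t -> 1 / (a + t) has Jacobian 1 / (a + t)^2. Both densities, at their
  arguments, have the same numerator a + s + t in \<open>1 + s * x\<close>, so the family is
  preserved and the constant left over is the digit probability.\<close>

lemma cyl_dens_step:
  assumes "s \<in> {0..1}" "t \<in> {0..1}"
  shows "cyl_dens s (1 / (real (Suc i) + t)) * (1 / (real (Suc i) + t)\<^sup>2) =
    digit_prob s (Suc i) * cyl_dens (1 / (real (Suc i) + s)) t"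
proof -
  define a where "a = real (Suc i)"
  have a: "a \<ge> 1" by (simp add: a_def)
  have 1: "a + t \<noteq> 0" "a + s \<noteq> 0" "a + s + 1 \<noteq> 0" "a + t + s \<noteq> 0"
    using a assms by auto
  have "1 + s * (1 / (a + t)) = (a + t + s) / (a + t)" using 1 by (simp add: field_simps)
  moreover have "1 + 1 / (a + s) * t = (a + t + s) / (a + s)" using 1 by (simp add: field_simps)
  moreover have "1 + 1 / (a + s) = (a + s + 1) / (a + s)" using 1 by (simp add: field_simps)
  ultimately show ?thesis
    unfolding cyl_dens_def digit_prob_def a_def[symmetric] using 1
    by (simp add: power_divide power2_eq_square)
qed

text \<open>The substitution \<open>x = 1 / (i + 2 - u)\<close> followed by \<open>u = 1 - t\<close> replaces the decreasing branch
  \<open>x = 1 / (i + 1 + t)\<close>, as the library's substitution rule wants an increasing map.\<close>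
lemma emeasure_cyl_law_branch:
  assumes s: "s \<in> {0..1}" and A: "A \<in> sets borel"
  shows "emeasure (cyl_law s) (A \<inter> {1 / (real i + 2)<..<1 / (real i + 1)}) =
    ennreal (digit_prob s (Suc i)) *
      emeasure (cyl_law (1 / (real (Suc i) + s))) {t. 1 / (real (Suc i) + t) \<in> A}"
proof -
  note [measurable] = A shift_measurable[OF A]
  define g where "g = (\<lambda>u. 1 / (real i + 2 - u))"
  define f where "f = (\<lambda>x. cyl_dens s x * indicator A x)"
  define r where "r = 1 / (real (Suc i) + s)"
  have g01: "g 0 = 1 / (real i + 2)" "g 1 = 1 / (real i + 1)" by (auto simp: g_def)
  have f [measurable]: "f \<in> borel_measurable borel" by (simp add: f_def)
  have "emeasure (cyl_law s) (A \<inter> {1 / (real i + 2)<..<1 / (real i + 1)}) =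
    (\<integral>\<^sup>+x. ennreal (f x) * indicator {g 0..g 1} x \<partial>lborel)"
  proof (subst emeasure_cyl_law, simp, rule nn_integral_cong_AE)
    have le: "x \<in> {0<..<1}" if "1 / (real i + 2) < x" "x < 1 / (real i + 1)" for x
    proof -
      have "1 / (real i + 1) \<le> 1" "0 < 1 / (real i + 2)" by auto
      then show ?thesis using less_trans[OF _ that(1)] less_le_trans[OF that(2)] by simp
    qed
    show "AE x in lborel. ennreal (cyl_dens s x * indicator (A \<inter> {1 / (real i + 2)<..<1 / (real i + 1)}) x *
            indicator {0<..<1} x) = ennreal (f x) * indicator {g 0..g 1} x"
      using AE_lborel_singleton[of "g 0"] AE_lborel_singleton[of "g 1"]
      by eventually_elim (use le in \<open>auto simp: f_def g01 indicator_def\<close>)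
  qed
  also have "\<dots> = (\<integral>\<^sup>+x. ennreal (f x * indicator {g 0..g 1} x) \<partial>lborel)"
    by (auto intro!: nn_integral_cong split: split_indicator)
  also have "\<dots> = (\<integral>\<^sup>+u. ennreal (f (g u) * (1 / (real i + 2 - u)\<^sup>2) * indicator {0..1} u) \<partial>lborel)"
  proof (rule nn_integral_substitution)
    show "set_borel_measurable borel {g 0..g 1} f"
      unfolding set_borel_measurable_def by measurable
    show "(g has_real_derivative 1 / (real i + 2 - x)\<^sup>2) (at x)" if "x \<in> {0..1}" for x
      unfolding g_def using that by (auto intro!: derivative_eq_intros simp: power2_eq_square)
    show "continuous_on {0..1} (\<lambda>u. 1 / (real i + 2 - u)\<^sup>2)"
      by (auto intro!: continuous_intros)
  qed auto
  also have "\<dots> = (\<integral>\<^sup>+t. ennreal (f (g (1 - t)) * (1 / (real i + 2 - (1 - t))\<^sup>2) * indicator {0..1} (1 - t)) \<partial>lborel)"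
    by (subst nn_integral_real_affine[where c = "-1" and t = 1]) (simp_all add: g_def)
  also have "\<dots> = (\<integral>\<^sup>+t. ennreal (digit_prob s (Suc i)) *
     ennreal (cyl_dens r t * indicator {t. 1 / (real (Suc i) + t) \<in> A} t * indicator {0<..<1} t) \<partial>lborel)"
  proof (rule nn_integral_cong_AE)
    have g1: "g (1 - t) = 1 / (real (Suc i) + t)" for t by (simp add: g_def add.commute)
    have g2: "real i + 2 - (1 - t) = real (Suc i) + t" for t by simp
    show "AE t in lborel. ennreal (f (g (1 - t)) * (1 / (real i + 2 - (1 - t))\<^sup>2) * indicator {0..1} (1 - t)) =
       ennreal (digit_prob s (Suc i)) *
         ennreal (cyl_dens r t * indicator {t. 1 / (real (Suc i) + t) \<in> A} t * indicator {0<..<1} t)"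
      using AE_lborel_singleton[of 0] AE_lborel_singleton[of 1]
    proof eventually_elim
      fix t :: real assume t: "t \<noteq> 0" "t \<noteq> 1"
      show "ennreal (f (g (1 - t)) * (1 / (real i + 2 - (1 - t))\<^sup>2) * indicator {0..1} (1 - t)) =
         ennreal (digit_prob s (Suc i)) *
         ennreal (cyl_dens r t * indicator {t. 1 / (real (Suc i) + t) \<in> A} t * indicator {0<..<1} t)"
      proof (cases "t \<in> {0<..<1} \<and> 1 / (real (Suc i) + t) \<in> A")
        case True
        then have "f (g (1 - t)) = cyl_dens s (1 / (real (Suc i) + t))"
          unfolding g1 f_def by (simp only: indicator_simps mult_1_right)
        then have "f (g (1 - t)) * (1 / (real i + 2 - (1 - t))\<^sup>2) = digit_prob s (Suc i) * cyl_dens r t"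
          unfolding g2 r_def using cyl_dens_step[OF s, of t i] True by (simp only: greaterThanLessThan_iff atLeastAtMost_iff less_imp_le)
        moreover have "indicator {0..1} (1 - t) = (1 :: real)" "indicator {0<..<1} t = (1 :: real)"
            "indicator {t. 1 / (real (Suc i) + t) \<in> A} t = (1 :: real)"
          using True by (auto intro!: indicator_eq_1_iff[THEN iffD2])
        ultimately show ?thesis
          by (simp only: mult_1_right ennreal_mult'[OF digit_prob_nonneg[OF s]])
      next
        case False
        then consider "t \<notin> {0<..<1}" | "1 / (real (Suc i) + t) \<notin> A" by blast
        then show ?thesis
        proof cases
          case 1
          then have "1 - t \<notin> {0..1}" using t by auto
          then have "indicator {0..1} (1 - t) = (0 :: real)" "indicator {0<..<1} t = (0 :: real)"
            using 1 by (simp_all only: indicator_eq_0_iff not_False_eq_True)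
          then show ?thesis by (simp only: mult_zero_right ennreal_0)
        next
          case 2
          then have "f (g (1 - t)) = 0" "indicator {t. 1 / (real (Suc i) + t) \<in> A} t = (0 :: real)"
            unfolding g1 f_def by simp_all
          then show ?thesis by (simp only: mult_zero_left mult_zero_right ennreal_0)
        qed
      qed
    qed
  qed
  also have "\<dots> = ennreal (digit_prob s (Suc i)) * emeasure (cyl_law r) {t. 1 / (real (Suc i) + t) \<in> A}"
    by (subst nn_integral_cmult) (simp_all add: emeasure_cyl_law[OF shift_measurable[OF A]])
  finally show ?thesis by (simp add: r_def)
qed

text \<open>One step of a Markov chain with state \<open>s\<close>: split by the first digit and
  pass to the new parameter. Every induction on the number of digits rests on this.\<close>

lemma emeasure_cyl_law_unfold:
  assumes s: "s \<in> {0..1}" and A: "A \<in> sets borel"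
  shows "emeasure (cyl_law s) A = (\<Sum>i. ennreal (digit_prob s (Suc i)) *
      emeasure (cyl_law (1 / (real (Suc i) + s))) {t. 1 / (real (Suc i) + t) \<in> A})"
proof -
  note [measurable] = A
  define J where "J i = {1 / (real i + 2)<..<1 / (real i + 1)}" for i :: nat
  have disj: "disjoint_family (\<lambda>i. A \<inter> J i)"
  proof -
    have "J i \<inter> J j = {}" if "i < j" for i j
    proof -
      have "1 / (real j + 1) \<le> 1 / (real i + 2)" using that by (intro divide_left_mono) auto
      then show ?thesis by (auto simp: J_def)
    qed
    then have "J i \<inter> J j = {}" if "i \<noteq> j" for i j
      using that by (metis Int_commute linorder_neqE_nat)
    then show ?thesis unfolding disjoint_family_on_def by blast
  qed
  \<comment> \<open>Away from reciprocals of integers \<open>1 / x\<close> is not an integer, so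
    \<open>x\<close> lies strictly between two neighbouring reciprocals. The exceptional points are
    countable, hence null.\<close>
  have cover: "x \<in> (\<Union>i. J i)" if x: "x \<in> {0<..<1}" and nx: "x \<notin> range (\<lambda>i::nat. 1 / real i)" for x
  proof -
    define n where "n = nat \<lfloor>1 / x\<rfloor>"
    have "1 / x > 1" using x by auto
    then have n: "n \<ge> 1" "real n \<le> 1 / x" "1 / x < real n + 1" unfolding n_def by linarith+
    have "x \<noteq> 1 / real n" using nx by blast
    then have "1 / x \<noteq> real n" by (metis div_by_1 divide_divide_eq_right mult_1)
    then have "real n < 1 / x" using n by simp
    then have "x < 1 / real n" "1 / (real n + 1) < x" using n x by (simp_all add: field_simps)
    moreover obtain i where "n = Suc i" using n(1) by (cases n) auto
    ultimately have "x \<in> J i" by (simp add: J_def add_ac)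
    then show ?thesis by auto
  qed
  have "AE x in lborel. x \<notin> range (\<lambda>i::nat. 1 / real i)"
    by (intro AE_not_in countable_imp_null_set_lborel) simp
  then have "AE x in cyl_law s. x \<notin> range (\<lambda>i::nat. 1 / real i)"
    unfolding cyl_law_def by (subst AE_density) (simp_all, elim eventually_mono, simp)
  then have "AE x in cyl_law s. x \<in> (\<Union>i. J i)"
    using AE_cyl_law[of s] by eventually_elim (erule (1) cover[rotated])
  then have "emeasure (cyl_law s) A = emeasure (cyl_law s) (\<Union>i. A \<inter> J i)"
    by (intro emeasure_eq_AE) (elim eventually_mono, auto simp: J_def)
  also have "\<dots> = (\<Sum>i. emeasure (cyl_law s) (A \<inter> J i))"
    by (intro suminf_emeasure[symmetric] disj) (auto simp: J_def)
  finally show ?thesis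
    unfolding J_def emeasure_cyl_law_branch[OF s A] .
qed

section \<open>The Gauss map and partial quotients along an inverse branch\<close>

lemma gauss_map_measurable [measurable]: "gauss_map \<in> borel_measurable borel"
  unfolding gauss_map_def[abs_def] frac_def by measurable

lemma gauss_map_funpow_measurable [measurable]: "(gauss_map ^^ n) \<in> borel_measurable borel"
  by (induction n) (auto simp: id_def[symmetric] comp_def intro: measurable_compose)

lemma partial_quotient_measurable [measurable]:
  "partial_quotient n \<in> measurable borel (count_space UNIV)"
  unfolding partial_quotient_def[abs_def] by measurable

lemma gauss_map_branch:
  assumes "t \<in> {0<..<1}"
  shows "gauss_map (1 / (real (Suc i) + t)) = t"
proof -
  have "frac (real (Suc i) + t) = t" using assms by (simp add: frac_unique_iff)
  moreover have "1 / (real (Suc i) + t) \<noteq> 0" using assms by auto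
  ultimately show ?thesis unfolding gauss_map_def by simp
qed

lemma funpow_gauss_map_branch:
  "t \<in> {0<..<1} \<Longrightarrow> (gauss_map ^^ Suc n) (1 / (real (Suc i) + t)) = (gauss_map ^^ n) t"
  by (simp only: funpow_Suc_right o_apply gauss_map_branch)

lemma branch_in_unit: "t \<in> {0<..<1} \<Longrightarrow> 1 / (real (Suc i) + t) \<in> {0<..<1}"
  by auto

lemma partial_quotient_branch:
  assumes "t \<in> {0<..<1}"
  shows "partial_quotient (Suc n) (1 / (real (Suc i) + t)) =
    (if n = 0 then Suc i else partial_quotient n t)"
proof (cases n)
  case 0
  have "\<lfloor>1 / (1 / (real (Suc i) + t))\<rfloor> = int (Suc i)"
    using assms by (subst floor_eq_iff) auto
  then show ?thesis using 0 by (simp only: partial_quotient_def diff_Suc_1 funpow_0 nat_int if_True refl)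
next
  case (Suc m)
  then show ?thesis
    by (simp only: partial_quotient_def diff_Suc_1 funpow_gauss_map_branch[OF assms]) simp
qed

text \<open>The restriction to \<open>i \<ge> 1\<close> comes from truncated subtraction:
  \<open>partial_quotient 0\<close> coincides with \<open>partial_quotient 1\<close>.\<close>

lemma partial_quotient_shift:
  "i \<ge> 1 \<Longrightarrow> partial_quotient i ((gauss_map ^^ m) x) = partial_quotient (m + i) x"
  by (simp add: partial_quotient_def flip: funpow_add[unfolded o_def, THEN fun_cong])
     (metis Nat.add_diff_assoc add.commute comp_apply funpow_add)

subsection \<open>Quasi-independence of past and future\<close>

text \<open>Stated by comparing points instead of listing cylinders, and only on the open unit
  interval, which carries all the mass of every \<open>cyl_law s\<close>.\<close>

definition digit_determined :: "nat \<Rightarrow> real set \<Rightarrow> bool" where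
  "digit_determined d A \<longleftrightarrow> A \<in> sets borel \<and>
    (\<forall>x\<in>{0<..<1}. \<forall>y\<in>{0<..<1}. (\<forall>i\<in>{1..d}. partial_quotient i x = partial_quotient i y) \<longrightarrow>
       (x \<in> A \<longleftrightarrow> y \<in> A))"

lemma digit_determinedI:
  assumes "A \<in> sets borel"
    and "\<And>x y. (\<And>i. 1 \<le> i \<Longrightarrow> i \<le> d \<Longrightarrow> partial_quotient i x = partial_quotient i y) \<Longrightarrow> x \<in> A \<Longrightarrow> y \<in> A"
  shows "digit_determined d A"
  unfolding digit_determined_def using assms by (metis atLeastAtMost_iff)

text \<open>Fixing the first digit uses up one of the digits that decide the event; this drives the
  inductions on \<open>d\<close>.\<close>

lemma digit_determined_branch:
  assumes "digit_determined (Suc d) A"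
  shows "digit_determined d {t. 1 / (real (Suc i) + t) \<in> A}"
  unfolding digit_determined_def
proof (intro conjI ballI impI)
  show "{t. 1 / (real (Suc i) + t) \<in> A} \<in> sets borel"
    using assms by (intro shift_measurable) (simp add: digit_determined_def)
next
  fix x y :: real
  assume xy: "x \<in> {0<..<1}" "y \<in> {0<..<1}"
    and eq: "\<forall>i\<in>{1..d}. partial_quotient i x = partial_quotient i y"
  have "partial_quotient j (1 / (real (Suc i) + x)) = partial_quotient j (1 / (real (Suc i) + y))"
    if "j \<in> {1..Suc d}" for j
  proof -
    have "1 \<le> j" "j \<le> Suc d" using that by auto
    then obtain n where n: "j = Suc n" "n \<le> d" by (metis One_nat_def Suc_le_D Suc_le_mono)
    show ?thesis unfolding n(1) partial_quotient_branch[OF xy(1)] partial_quotient_branch[OF xy(2)]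
      using eq n by auto
  qed
  then have "1 / (real (Suc i) + x) \<in> A \<longleftrightarrow> 1 / (real (Suc i) + y) \<in> A"
    using assms branch_in_unit[OF xy(1)] branch_in_unit[OF xy(2)]
    unfolding digit_determined_def by blast
  then show "(x \<in> {t. 1 / (real (Suc i) + t) \<in> A}) = (y \<in> {t. 1 / (real (Suc i) + t) \<in> A})"
    by blast
qed

lemma digit_determined_0:
  assumes "digit_determined 0 A"
  obtains "A \<inter> {0<..<1} = {}" | "A \<inter> {0<..<1} = {0<..<1}"
  using assms unfolding digit_determined_def by fastforce

lemma vimage_funpow_measurable:
  "B \<in> sets borel \<Longrightarrow> (gauss_map ^^ d) -` B \<in> sets borel"
  using measurable_sets[OF gauss_map_funpow_measurable, of B d] by simp

lemma emeasure_cylinder_unfold: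
  assumes s: "s \<in> {0..1}" and A: "A \<in> sets borel" and B: "B \<in> sets borel"
  shows "emeasure (cyl_law s) (A \<inter> (gauss_map ^^ Suc d) -` B) =
    (\<Sum>i. ennreal (digit_prob s (Suc i)) * emeasure (cyl_law (1 / (real (Suc i) + s)))
      ({t. 1 / (real (Suc i) + t) \<in> A} \<inter> (gauss_map ^^ d) -` B))"
proof -
  have AB: "A \<inter> (gauss_map ^^ Suc d) -` B \<in> sets borel"
    using A vimage_funpow_measurable[OF B] by blast
  have "emeasure (cyl_law r) {t. 1 / (real (Suc i) + t) \<in> A \<inter> (gauss_map ^^ Suc d) -` B} =
    emeasure (cyl_law r) ({t. 1 / (real (Suc i) + t) \<in> A} \<inter> (gauss_map ^^ d) -` B)" for r i
  proof (rule emeasure_cyl_law_cong)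
    show "{t. 1 / (real (Suc i) + t) \<in> A} \<inter> (gauss_map ^^ d) -` B \<in> sets borel"
      using shift_measurable[OF A] vimage_funpow_measurable[OF B] by blast
  qed (use shift_measurable[OF AB] funpow_gauss_map_branch in auto)
  then show ?thesis unfolding emeasure_cyl_law_unfold[OF s AB] by simp
qed

text \<open>Unfolding one digit changes only the parameter, and the bound on \<open>B\<close> holds
  for all parameters. When no digit is left, the past event is null or has full mass.\<close>

lemma emeasure_cylinder_le:
  assumes "digit_determined d A" and B: "B \<in> sets borel"
    and bnd: "\<And>r. r \<in> {0..1} \<Longrightarrow> emeasure (cyl_law r) B \<le> c" and "s \<in> {0..1}"
  shows "emeasure (cyl_law s) (A \<inter> (gauss_map ^^ d) -` B) \<le> emeasure (cyl_law s) A * c"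
  using assms(1,4)
proof (induction d arbitrary: A s)
  case 0
  have A: "A \<in> sets borel" using 0 by (simp add: digit_determined_def)
  from 0(1) show ?case
  proof (cases rule: digit_determined_0)
    case 1
    then have "emeasure (cyl_law s) (A \<inter> B) = emeasure (cyl_law s) {}"
      using A B by (intro emeasure_cyl_law_cong) auto
    then show ?thesis by simp
  next
    case 2
    have "emeasure (cyl_law s) (A \<inter> B) = emeasure (cyl_law s) B"
      "emeasure (cyl_law s) A = emeasure (cyl_law s) UNIV"
      using A B 2 by (intro emeasure_cyl_law_cong; auto)+
    then show ?thesis using bnd[OF 0(2)] emeasure_cyl_law_UNIV[OF 0(2)] by simp
  qed
next
  case (Suc d)
  have A: "A \<in> sets borel" using Suc by (simp add: digit_determined_def)
  have "emeasure (cyl_law s) (A \<inter> (gauss_map ^^ Suc d) -` B) \<le>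
    (\<Sum>i. ennreal (digit_prob s (Suc i)) * emeasure (cyl_law (1 / (real (Suc i) + s)))
      {t. 1 / (real (Suc i) + t) \<in> A} * c)"
    unfolding emeasure_cylinder_unfold[OF Suc.prems(2) A B] mult.assoc
    by (intro suminf_le mult_left_mono Suc.IH digit_determined_branch Suc.prems next_state) auto
  also have "\<dots> = emeasure (cyl_law s) A * c"
    by (simp only: ennreal_suminf_multc emeasure_cyl_law_unfold[OF Suc.prems(2) A])
  finally show ?case .
qed

text \<open>The same induction with the inequality reversed.\<close>

lemma emeasure_cylinder_ge:
  assumes "digit_determined d A" and B: "B \<in> sets borel"
    and bnd: "\<And>r. r \<in> {0..1} \<Longrightarrow> c \<le> emeasure (cyl_law r) B" and "s \<in> {0..1}"
  shows "emeasure (cyl_law s) A * c \<le> emeasure (cyl_law s) (A \<inter> (gauss_map ^^ d) -` B)"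
  using assms(1,4)
proof (induction d arbitrary: A s)
  case 0
  have A: "A \<in> sets borel" using 0 by (simp add: digit_determined_def)
  from 0(1) show ?case
  proof (cases rule: digit_determined_0)
    case 1
    then have "emeasure (cyl_law s) A = emeasure (cyl_law s) {}"
      using A B by (intro emeasure_cyl_law_cong) auto
    then show ?thesis by simp
  next
    case 2
    have "emeasure (cyl_law s) (A \<inter> B) = emeasure (cyl_law s) B"
      "emeasure (cyl_law s) A = emeasure (cyl_law s) UNIV"
      using A B 2 by (intro emeasure_cyl_law_cong; auto)+
    then show ?thesis using bnd[OF 0(2)] emeasure_cyl_law_UNIV[OF 0(2)] by simp
  qed
next
  case (Suc d)
  have A: "A \<in> sets borel" using Suc by (simp add: digit_determined_def)
  have "emeasure (cyl_law s) A * c = (\<Sum>i. ennreal (digit_prob s (Suc i)) *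
      emeasure (cyl_law (1 / (real (Suc i) + s))) {t. 1 / (real (Suc i) + t) \<in> A} * c)"
    by (simp only: ennreal_suminf_multc emeasure_cyl_law_unfold[OF Suc.prems(2) A])
  also have "\<dots> \<le> emeasure (cyl_law s) (A \<inter> (gauss_map ^^ Suc d) -` B)"
    unfolding emeasure_cylinder_unfold[OF Suc.prems(2) A B] mult.assoc
    by (intro suminf_le mult_left_mono Suc.IH digit_determined_branch Suc.prems next_state) auto
  finally show ?case .
qed

section \<open>Real-valued probabilities under the conditional laws\<close>

abbreviation pr :: "real \<Rightarrow> real set \<Rightarrow> real" where
  "pr s \<equiv> measure (cyl_law s)"

lemma finite_measure_cyl_law: "s \<in> {0..1} \<Longrightarrow> finite_measure (cyl_law s)"
  by (rule finite_measureI) (simp add: emeasure_cyl_law_UNIV)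

lemma emeasure_eq_pr: "s \<in> {0..1} \<Longrightarrow> emeasure (cyl_law s) A = ennreal (pr s A)"
  by (rule finite_measure.emeasure_eq_measure[OF finite_measure_cyl_law])

lemma pr_UNIV: "s \<in> {0..1} \<Longrightarrow> pr s UNIV = 1"
  by (simp add: measure_def emeasure_cyl_law_UNIV)

lemma pr_mono: "s \<in> {0..1} \<Longrightarrow> A \<subseteq> B \<Longrightarrow> B \<in> sets borel \<Longrightarrow> pr s A \<le> pr s B"
  by (rule finite_measure.finite_measure_mono[OF finite_measure_cyl_law]) auto

lemma pr_le_1: "s \<in> {0..1} \<Longrightarrow> A \<in> sets borel \<Longrightarrow> pr s A \<le> 1"
  using pr_mono[of s A UNIV] pr_UNIV by simp

lemma pr_compl: "s \<in> {0..1} \<Longrightarrow> A \<in> sets borel \<Longrightarrow> pr s (- A) = 1 - pr s A"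
  using finite_measure.finite_measure_compl[OF finite_measure_cyl_law, of s A]
  by (simp add: pr_UNIV Compl_eq_Diff_UNIV)

lemma pr_cylinder_le:
  assumes "digit_determined d A" and "B \<in> sets borel"
    and "\<And>r. r \<in> {0..1} \<Longrightarrow> pr r B \<le> c" and s: "s \<in> {0..1}"
  shows "pr s (A \<inter> (gauss_map ^^ d) -` B) \<le> pr s A * c"
proof -
  have c: "c \<ge> 0" using assms(3)[of 0] order_trans[OF measure_nonneg] by auto
  have "emeasure (cyl_law s) (A \<inter> (gauss_map ^^ d) -` B) \<le> emeasure (cyl_law s) A * ennreal c"
    by (rule emeasure_cylinder_le[OF assms(1,2) _ s]) (use assms(3) in \<open>simp add: emeasure_eq_pr ennreal_leI\<close>)
  then show ?thesis using c by (simp add: emeasure_eq_pr[OF s] ennreal_mult'[symmetric] del: ennreal_mult')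
qed

lemma pr_cylinder_ge:
  assumes "digit_determined d A" and "B \<in> sets borel"
    and "\<And>r. r \<in> {0..1} \<Longrightarrow> c \<le> pr r B" and s: "s \<in> {0..1}" and c: "c \<ge> 0"
  shows "pr s A * c \<le> pr s (A \<inter> (gauss_map ^^ d) -` B)"
proof -
  have "emeasure (cyl_law s) A * ennreal c \<le> emeasure (cyl_law s) (A \<inter> (gauss_map ^^ d) -` B)"
    by (rule emeasure_cylinder_ge[OF assms(1,2) _ s]) (use assms(3) in \<open>simp add: emeasure_eq_pr ennreal_leI\<close>)
  then show ?thesis using c by (simp add: emeasure_eq_pr[OF s] ennreal_mult'[symmetric] del: ennreal_mult')
qed

lemma digit_determined_UNIV: "digit_determined d UNIV"
  by (rule digit_determinedI) auto

text \<open>Uniformity in the parameter replaces invariance of the measure: take the trivial event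
  as the past.\<close>

lemma pr_vimage_le:
  assumes "B \<in> sets borel" "\<And>r. r \<in> {0..1} \<Longrightarrow> pr r B \<le> c" "s \<in> {0..1}"
  shows "pr s ((gauss_map ^^ d) -` B) \<le> c"
  using pr_cylinder_le[OF digit_determined_UNIV assms, of d] by (simp only: Int_UNIV_left pr_UNIV[OF assms(3)] mult_1)

subsection \<open>Large digits and large products of two digits\<close>

definition digit_ge :: "real \<Rightarrow> real set" where
  "digit_ge y = {x. real (partial_quotient 1 x) \<ge> y}"

definition pair_ge :: "real \<Rightarrow> real set" where
  "pair_ge y = {x. real (partial_quotient 1 x * partial_quotient 2 x) \<ge> y}"

definition digit_eq :: "nat \<Rightarrow> real set" where
  "digit_eq b = {x. partial_quotient 1 x = b}"

lemma digit_ge_determined: "digit_determined 1 (digit_ge y)"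
proof (rule digit_determinedI)
  show "digit_ge y \<in> sets borel" unfolding digit_ge_def by measurable
qed (simp add: digit_ge_def)

lemma pair_ge_determined: "digit_determined 2 (pair_ge y)"
proof (rule digit_determinedI)
  show "pair_ge y \<in> sets borel" unfolding pair_ge_def by measurable
qed (simp add: pair_ge_def)

lemma digit_eq_determined: "digit_determined 1 (digit_eq b)"
proof (rule digit_determinedI)
  show "digit_eq b \<in> sets borel" unfolding digit_eq_def by measurable
qed (simp add: digit_eq_def)

lemma digit_ge_sets [measurable]: "digit_ge y \<in> sets borel"
  and pair_ge_sets [measurable]: "pair_ge y \<in> sets borel"
  and digit_eq_sets [measurable]: "digit_eq b \<in> sets borel"
  using digit_ge_determined pair_ge_determined digit_eq_determined by (simp_all add: digit_determined_def)

lemma pr_cong: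
  "A \<inter> {0<..<1} = B \<inter> {0<..<1} \<Longrightarrow> A \<in> sets borel \<Longrightarrow> B \<in> sets borel \<Longrightarrow> pr s A = pr s B"
  unfolding measure_def by (rule arg_cong[OF emeasure_cyl_law_cong])

lemma pr_initial:
  assumes "s \<in> {0..1}" "c \<in> {0..1}"
  shows "pr s {0<..<c} = (1 + s) * c / (1 + s * c)"
  using assms by (simp add: measure_def emeasure_cyl_law_initial)

lemma pr_initial_inverse:
  assumes "s \<in> {0..1}" "y \<ge> 1"
  shows "pr s {0<..<1 / y} = (1 + s) / (y + s)"
proof -
  have "1 + s * (1 / y) = (y + s) / y" using assms by (simp add: field_simps)
  then show ?thesis using assms by (subst pr_initial) simp_all
qed

text \<open>The endpoint is null. The closed form is wanted because \<open>1 / b\<close> itself has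
  first digit \<open>b\<close>.\<close>

lemma pr_initial_closed:
  assumes s: "s \<in> {0..1}" and y: "y \<ge> 1"
  shows "pr s {0<..1 / y} = (1 + s) / (y + s)"
proof -
  have "emeasure (cyl_law s) {0<..1 / y} = emeasure (cyl_law s) {0<..<1 / y}"
  proof (rule emeasure_eq_AE)
    have "AE x in lborel. x \<noteq> 1 / y" by (rule AE_lborel_singleton)
    then have "AE x in cyl_law s. x \<noteq> 1 / y"
      unfolding cyl_law_def by (subst AE_density) (measurable, erule eventually_mono, blast)
    then show "AE x in cyl_law s. (x \<in> {0<..1 / y}) = (x \<in> {0<..<1 / y})"
      by eventually_elim auto
  qed auto
  then show ?thesis using pr_initial_inverse[OF s y] by (simp add: measure_def)
qed

lemma partial_quotient_1: "partial_quotient 1 x = nat \<lfloor>1 / x\<rfloor>"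
  by (simp add: partial_quotient_def)

lemma pr_digit_ge_le:
  assumes s: "s \<in> {0..1}" and y: "y > 0"
  shows "pr s (digit_ge y) \<le> 2 / y"
proof (cases "y \<ge> 1")
  case True
  have "pr s (digit_ge y) = pr s (digit_ge y \<inter> {0<..<1})" by (rule pr_cong) auto
  also have "\<dots> \<le> pr s {0<..1 / y}"
  proof (rule pr_mono[OF s])
    show "digit_ge y \<inter> {0<..<1} \<subseteq> {0<..1 / y}"
    proof
      fix x assume x: "x \<in> digit_ge y \<inter> {0<..<1}"
      then have "y \<le> real (nat \<lfloor>1 / x\<rfloor>)" unfolding digit_ge_def partial_quotient_1 by blast
      also have "\<dots> \<le> 1 / x" using x by simp
      finally show "x \<in> {0<..1 / y}" using x y by (simp add: field_simps)
    qed
  qed simp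
  also have "\<dots> = (1 + s) / (y + s)" by (rule pr_initial_closed[OF s True])
  also have "\<dots> \<le> 2 / y" using s y by (intro frac_le) auto
  finally show ?thesis .
next
  case False
  then have "1 \<le> 2 / y" using y by (simp add: field_simps)
  then show ?thesis using pr_le_1[OF s digit_ge_sets] order_trans by blast
qed

text \<open>If \<open>1 / x\<close> is at least \<open>y + 1\<close>, its floor is at least
  \<open>y\<close>. With \<open>y + 1\<close> in the denominator the bound covers all positive
  \<open>y\<close>, as a bounded \<open>\<phi>\<close> requires.\<close>

lemma pr_digit_ge_ge:
  assumes s: "s \<in> {0..1}" and y: "y > 0"
  shows "1 / (y + 1) \<le> pr s (digit_ge y)"
proof -
  have "(y + 1 + s) \<le> (1 + s) * (y + 1)" using s y by (simp add: algebra_simps)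
  then have "1 / (y + 1) \<le> (1 + s) / (y + 1 + s)" using s y by (simp add: field_simps)
  also have "\<dots> = pr s {0<..<1 / (y + 1)}"
    using s y by (subst pr_initial_inverse) auto
  also have "\<dots> \<le> pr s (digit_ge y)"
  proof (rule pr_mono[OF s])
    show "{0<..<1 / (y + 1)} \<subseteq> digit_ge y"
    proof
      fix x assume x: "x \<in> {0<..<1 / (y + 1)}"
      then have "y + 1 \<le> 1 / x" using y by (simp add: field_simps)
      then show "x \<in> digit_ge y" unfolding digit_ge_def partial_quotient_1 by simp linarith
    qed
  qed simp
  finally show ?thesis .
qed

lemma pr_digit_eq:
  assumes s: "s \<in> {0..1}" and b: "b \<ge> 1"
  shows "pr s (digit_eq b) = digit_prob s b"
proof -
  have iff: "partial_quotient 1 x = b \<longleftrightarrow> x \<in> {0<..1 / real b} - {0<..1 / (real b + 1)}"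
    if x: "x \<in> {0<..<1}" for x
  proof -
    have "partial_quotient 1 x = b \<longleftrightarrow> \<lfloor>1 / x\<rfloor> = int b"
      unfolding partial_quotient_1 using b x by auto
    also have "\<dots> \<longleftrightarrow> real b \<le> 1 / x \<and> 1 / x < real b + 1" by (simp add: floor_eq_iff)
    also have "\<dots> \<longleftrightarrow> x \<in> {0<..1 / real b} - {0<..1 / (real b + 1)}"
      using x b by (auto simp: field_simps)
    finally show ?thesis .
  qed
  have "pr s (digit_eq b) = pr s ({0<..1 / real b} - {0<..1 / (real b + 1)})"
    by (rule pr_cong) (use iff in \<open>unfold digit_eq_def, blast\<close>, auto)
  also have "\<dots> = pr s {0<..1 / real b} - pr s {0<..1 / (real b + 1)}"
    using b by (intro finite_measure.finite_measure_Diff[OF finite_measure_cyl_law[OF s]])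
      (auto simp: field_simps intro: order_trans)
  also have "\<dots> = (1 + s) / (b + s) - (1 + s) / (b + 1 + s)"
    using pr_initial_closed[OF s, of "real b"] pr_initial_closed[OF s, of "real b + 1"] b by simp
  also have "\<dots> = digit_prob s b"
    unfolding digit_prob_def using s b by (simp add: divide_simps) (simp add: algebra_simps)
  finally show ?thesis .
qed

lemma digit_prob_le:
  assumes "s \<in> {0..1}" "b \<ge> 1"
  shows "digit_prob s b \<le> 2 / (real b)\<^sup>2"
  unfolding digit_prob_def power2_eq_square using assms
  by (intro frac_le mult_mono mult_pos_pos) auto

lemma digit_prob_ge:
  assumes "s \<in> {0..1}" "b \<ge> 1"
  shows "1 / (6 * (real b)\<^sup>2) \<le> digit_prob s b"
proof -
  have "(real b + s) * (real b + s + 1) \<le> (2 * real b) * (3 * real b)"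
    using assms by (intro mult_mono) auto
  also have "\<dots> = 6 * (real b)\<^sup>2" by (simp add: power2_eq_square)
  finally show ?thesis unfolding digit_prob_def using assms by (intro frac_le) auto
qed

lemma pr_digit_eq_le: "s \<in> {0..1} \<Longrightarrow> b \<ge> 1 \<Longrightarrow> pr s (digit_eq b) \<le> 2 / (real b)\<^sup>2"
  by (simp only: pr_digit_eq digit_prob_le)

lemma partial_quotient_2: "partial_quotient 2 x = partial_quotient 1 (gauss_map x)"
  using partial_quotient_shift[of 1 1 x] by (simp add: numeral_2_eq_2)

text \<open>First digit exactly \<open>b\<close>, second at least \<open>y / b\<close>, written as a
  past event and a shifted future event so that quasi-independence applies.\<close>

definition pair_cell :: "real \<Rightarrow> nat \<Rightarrow> real set" where
  "pair_cell y b = digit_eq b \<inter> (gauss_map ^^ 1) -` digit_ge (y / real b)"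

lemma pair_cell_sets [measurable]: "pair_cell y b \<in> sets borel"
  unfolding pair_cell_def using vimage_funpow_measurable[OF digit_ge_sets] digit_eq_sets by blast

lemma pair_cell_iff:
  assumes "b \<ge> 1"
  shows "x \<in> pair_cell y b \<longleftrightarrow> partial_quotient 1 x = b \<and> y \<le> real b * real (partial_quotient 1 (gauss_map x))"
proof -
  have "y / real b \<le> c \<longleftrightarrow> y \<le> real b * c" for c using assms by (simp add: field_simps)
  then show ?thesis by (simp add: pair_cell_def digit_eq_def digit_ge_def)
qed

lemma pair_ge_iff: "x \<in> pair_ge y \<longleftrightarrow> y \<le> real (partial_quotient 1 x) * real (partial_quotient 1 (gauss_map x))"
  by (simp only: pair_ge_def partial_quotient_2 mem_Collect_eq of_nat_mult)

text \<open>All first digits that reach \<open>y\<close> alone are lumped into one event, so only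
  the cells with \<open>b \<le> y\<close> remain and their sum is a harmonic sum of length about
  \<open>y\<close>.\<close>

lemma pair_ge_subset:
  assumes y: "y > 0"
  shows "pair_ge y \<subseteq> digit_ge y \<union> (\<Union>b\<in>{1..nat \<lfloor>y\<rfloor>}. pair_cell y b)"
proof
  fix x assume x: "x \<in> pair_ge y"
  define b where "b = partial_quotient 1 x"
  have bc: "y \<le> real b * real (partial_quotient 1 (gauss_map x))"
    using x by (simp only: pair_ge_iff b_def)
  then have b0: "b \<ge> 1" using y by (cases b) auto
  show "x \<in> digit_ge y \<union> (\<Union>b\<in>{1..nat \<lfloor>y\<rfloor>}. pair_cell y b)"
  proof (cases "real b \<ge> y")
    case True
    then show ?thesis by (simp add: digit_ge_def b_def)
  next
    case False
    then have "b \<in> {1..nat \<lfloor>y\<rfloor>}" using b0 by (simp add: le_nat_floor)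
    moreover have "x \<in> pair_cell y b"
      using bc b_def unfolding pair_cell_iff[OF b0] by simp
    ultimately show ?thesis by blast
  qed
qed

text \<open>The first digit costs 2 / b^2 and the second 2 b / y; the product decays like 1 / b, the
  source of the logarithm.\<close>

lemma pr_pair_cell_le:
  assumes s: "s \<in> {0..1}" and y: "y > 0" and b: "b \<ge> 1"
  shows "pr s (pair_cell y b) \<le> 4 / (y * real b)"
proof -
  have pb: "y / real b > 0" using y b by simp
  have "pr s (pair_cell y b) \<le> pr s (digit_eq b) * (2 / (y / real b))"
    unfolding pair_cell_def
    by (intro pr_cylinder_le[OF digit_eq_determined] s digit_ge_sets pr_digit_ge_le pb)
  also have "\<dots> \<le> (2 / (real b)\<^sup>2) * (2 / (y / real b))"
    using y by (intro mult_right_mono pr_digit_eq_le s b) auto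
  also have "\<dots> = 4 / (y * real b)" using b y by (simp add: power2_eq_square)
  finally show ?thesis .
qed

text \<open>Since \<open>b \<le> y\<close>, one has y / b + 1 \<le> 2 y / b; the constant 12 is this
  2 times the 6 of \<open>digit_prob_ge\<close>.\<close>

lemma pr_pair_cell_ge:
  assumes s: "s \<in> {0..1}" and y: "y > 0" and b: "b \<ge> 1" "real b \<le> y"
  shows "1 / (12 * y) * (1 / real b) \<le> pr s (pair_cell y b)"
proof -
  have b0: "real b > 0" using b by simp
  have pb: "y / real b > 0" using y b0 by simp
  have "y / real b + 1 \<le> 2 * y / real b" using b b0 by (simp add: field_simps)
  then have 1: "1 / (2 * y / real b) \<le> 1 / (y / real b + 1)"
    using pb y b0 by (intro divide_left_mono mult_pos_pos add_pos_pos divide_pos_pos) auto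
  have "1 / (12 * y) * (1 / real b) = 1 / (6 * (real b)\<^sup>2) * (1 / (2 * y / real b))"
    using b0 y by (simp add: power2_eq_square)
  also have "\<dots> \<le> digit_prob s b * (1 / (y / real b + 1))"
    using y by (intro mult_mono digit_prob_ge[OF s b(1)] 1 digit_prob_nonneg[OF s]) auto
  also have "\<dots> = pr s (digit_eq b) * (1 / (y / real b + 1))"
    by (simp only: pr_digit_eq[OF s b(1)])
  also have "\<dots> \<le> pr s (pair_cell y b)"
    unfolding pair_cell_def using pb
    by (intro pr_cylinder_ge[OF digit_eq_determined] s digit_ge_sets pr_digit_ge_ge) auto
  finally show ?thesis .
qed

text \<open>The difference between the harmonic number and the logarithm decreases from its value 1
  at index 1.\<close>

lemma harm_nat_floor_le:
  assumes "y \<ge> 1"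
  shows "(\<Sum>b\<in>{1..nat \<lfloor>y\<rfloor>}. 1 / real b) \<le> 1 + ln y"
proof -
  have n: "nat \<lfloor>y\<rfloor> \<ge> 1" "real (nat \<lfloor>y\<rfloor>) \<le> y" using assms by (auto simp: le_nat_iff)
  have "(\<Sum>b\<in>{1..nat \<lfloor>y\<rfloor>}. 1 / real b) = harm (nat \<lfloor>y\<rfloor>)"
    by (simp add: harm_def inverse_eq_divide)
  also have "\<dots> \<le> ln (real (nat \<lfloor>y\<rfloor>)) + 1"
    using n euler_mascheroni_sequence_decreasing[of 1 "nat \<lfloor>y\<rfloor>"] by (simp add: harm_expand)
  also have "\<dots> \<le> 1 + ln y" using n by simp
  finally show ?thesis .
qed

lemma pr_union_le:
  assumes "s \<in> {0..1}" "finite I" "A \<in> sets borel" "\<And>i. i \<in> I \<Longrightarrow> B i \<in> sets borel"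
    and "X \<subseteq> A \<union> (\<Union>i\<in>I. B i)"
  shows "pr s X \<le> pr s A + (\<Sum>i\<in>I. pr s (B i))"
proof -
  interpret finite_measure "cyl_law s" by (rule finite_measure_cyl_law[OF assms(1)])
  have "pr s X \<le> pr s (A \<union> (\<Union>i\<in>I. B i))"
    using assms by (intro pr_mono) auto
  also have "\<dots> \<le> pr s A + pr s (\<Union>i\<in>I. B i)"
    using assms by (intro measure_Un_le) auto
  also have "\<dots> \<le> pr s A + (\<Sum>i\<in>I. pr s (B i))"
    using assms by (intro add_left_mono measure_UNION_le) auto
  finally show ?thesis .
qed

lemma pr_pair_ge_le:
  assumes s: "s \<in> {0..1}" and y: "y \<ge> 1"
  shows "pr s (pair_ge y) \<le> (6 + 4 * ln y) / y"
proof -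
  have y0: "y > 0" using y by simp
  have "(\<Sum>b\<in>{1..nat \<lfloor>y\<rfloor>}. pr s (pair_cell y b)) \<le> (\<Sum>b\<in>{1..nat \<lfloor>y\<rfloor>}. (4 / y) * (1 / real b))"
  proof (rule sum_mono)
    fix b assume "b \<in> {1..nat \<lfloor>y\<rfloor>}"
    then show "pr s (pair_cell y b) \<le> (4 / y) * (1 / real b)"
      using pr_pair_cell_le[OF s y0, of b] by simp
  qed
  also have "\<dots> \<le> (4 / y) * (1 + ln y)"
    unfolding sum_distrib_left[symmetric] using y by (intro mult_left_mono harm_nat_floor_le) auto
  finally have "(\<Sum>b\<in>{1..nat \<lfloor>y\<rfloor>}. pr s (pair_cell y b)) \<le> (4 / y) * (1 + ln y)" .
  moreover have "pr s (pair_ge y) \<le> pr s (digit_ge y) + (\<Sum>b\<in>{1..nat \<lfloor>y\<rfloor>}. pr s (pair_cell y b))"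
    by (intro pr_union_le s pair_ge_subset y0) auto
  moreover have "pr s (digit_ge y) \<le> 2 / y" by (rule pr_digit_ge_le[OF s y0])
  moreover have "2 / y + (4 / y) * (1 + ln y) = (6 + 4 * ln y) / y" using y by (simp add: field_simps)
  ultimately show ?thesis by linarith
qed

text \<open>Sum over the shared middle digit b. Either b alone reaches \<open>y\<close>, at cost 2 /
  y, or both outer digits are at least y / b. In that case the factors 2 b / y and 4 / (y b)
  multiply to 8 / y^2, free of b, for at most \<open>y\<close> values of b, so no logarithm
  appears.\<close>

lemma pr_adjacent_pairs_le:
  assumes s: "s \<in> {0..1}" and y: "y \<ge> 1"
  shows "pr s (pair_ge y \<inter> (gauss_map ^^ 1) -` pair_ge y) \<le> 10 / y"
proof -
  have y0: "y > 0" using y by simp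
  let ?C = "\<lambda>b. digit_ge (y / real b) \<inter> (gauss_map ^^ 1) -` pair_cell y b"
  have C: "?C b \<in> sets borel" for b
    using vimage_funpow_measurable[OF pair_cell_sets] digit_ge_sets by blast
  have sub: "pair_ge y \<inter> (gauss_map ^^ 1) -` pair_ge y \<subseteq>
    (gauss_map ^^ 1) -` digit_ge y \<union> (\<Union>b\<in>{1..nat \<lfloor>y\<rfloor>}. ?C b)"
  proof
    fix x assume x: "x \<in> pair_ge y \<inter> (gauss_map ^^ 1) -` pair_ge y"
    then have "gauss_map x \<in> pair_ge y" by simp
    then consider "gauss_map x \<in> digit_ge y" | b where "b \<in> {1..nat \<lfloor>y\<rfloor>}" "gauss_map x \<in> pair_cell y b"
      using pair_ge_subset[OF y0] by blast
    then show "x \<in> (gauss_map ^^ 1) -` digit_ge y \<union> (\<Union>b\<in>{1..nat \<lfloor>y\<rfloor>}. ?C b)"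
    proof cases
      case (2 b)
      then have b: "b \<ge> 1" "real b > 0" by auto
      have "y \<le> real (partial_quotient 1 x) * real b"
        using x 2(2) by (simp add: pair_ge_iff pair_cell_iff[OF b(1)])
      then have "x \<in> digit_ge (y / real b)"
        using b(2) by (simp add: digit_ge_def field_simps)
      then show ?thesis using 2 by auto
    qed simp
  qed
  have C_le: "pr s (?C b) \<le> 8 / y\<^sup>2" if b: "b \<in> {1..nat \<lfloor>y\<rfloor>}" for b
  proof -
    have b1: "b \<ge> 1" using b by simp
    then have pb: "y / real b > 0" using y0 by simp
    have "pr s (?C b) \<le> pr s (digit_ge (y / real b)) * (4 / (y * real b))"
      by (intro pr_cylinder_le[OF digit_ge_determined] pair_cell_sets pr_pair_cell_le s y0 b1)
    also have "\<dots> \<le> (2 / (y / real b)) * (4 / (y * real b))"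
      using y0 by (intro mult_right_mono pr_digit_ge_le[OF s pb]) auto
    also have "\<dots> = 8 / y\<^sup>2" using b1 y0 by (simp add: power2_eq_square)
    finally show ?thesis .
  qed
  have "(\<Sum>b\<in>{1..nat \<lfloor>y\<rfloor>}. pr s (?C b)) \<le> (\<Sum>b\<in>{1..nat \<lfloor>y\<rfloor>}. 8 / y\<^sup>2)"
    by (rule sum_mono) (rule C_le)
  also have "\<dots> \<le> y * (8 / y\<^sup>2)"
    unfolding sum_constant using y by (intro mult_right_mono) auto
  also have "\<dots> = 8 / y" using y by (simp add: power2_eq_square)
  finally have "(\<Sum>b\<in>{1..nat \<lfloor>y\<rfloor>}. pr s (?C b)) \<le> 8 / y" .
  moreover have "pr s ((gauss_map ^^ 1) -` digit_ge y) \<le> 2 / y"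
    by (intro pr_vimage_le s digit_ge_sets pr_digit_ge_le y0)
  moreover have "pr s (pair_ge y \<inter> (gauss_map ^^ 1) -` pair_ge y) \<le>
      pr s ((gauss_map ^^ 1) -` digit_ge y) + (\<Sum>b\<in>{1..nat \<lfloor>y\<rfloor>}. pr s (?C b))"
    by (intro pr_union_le s vimage_funpow_measurable digit_ge_sets C sub) simp
  moreover have "2 / y + 8 / y = 10 / y" by simp
  ultimately show ?thesis by linarith
qed

text \<open>Cells with different first digits are disjoint, so their lower bounds add up to a
  harmonic sum. For \<open>y < 1\<close> the left side is negative.\<close>

lemma pr_pair_ge_ge:
  assumes s: "s \<in> {0..1}" and y: "y > 0"
  shows "ln y / (12 * y) \<le> pr s (pair_ge y)"
proof (cases "y \<ge> 1")
  case True
  interpret finite_measure "cyl_law s" by (rule finite_measure_cyl_law[OF s])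
  have "y \<le> real (nat \<lfloor>y\<rfloor>) + 1" using True by linarith
  then have "ln y \<le> ln (real (nat \<lfloor>y\<rfloor>) + 1)"
    using True by (intro ln_mono) auto
  also have "\<dots> \<le> harm (nat \<lfloor>y\<rfloor>)" by (rule ln_le_harm)
  finally have "ln y \<le> (\<Sum>b\<in>{1..nat \<lfloor>y\<rfloor>}. 1 / real b)"
    by (simp add: harm_def inverse_eq_divide)
  then have "1 / (12 * y) * ln y \<le> 1 / (12 * y) * (\<Sum>b\<in>{1..nat \<lfloor>y\<rfloor>}. 1 / real b)"
    using y by (intro mult_left_mono) auto
  also have "\<dots> \<le> (\<Sum>b\<in>{1..nat \<lfloor>y\<rfloor>}. pr s (pair_cell y b))"
    unfolding sum_distrib_left
  proof (rule sum_mono)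
    fix b assume b: "b \<in> {1..nat \<lfloor>y\<rfloor>}"
    then have "real b \<le> real (nat \<lfloor>y\<rfloor>)" by simp
    also have "\<dots> \<le> y" using y by simp
    finally show "1 / (12 * y) * (1 / real b) \<le> pr s (pair_cell y b)"
      using b by (intro pr_pair_cell_ge s y) auto
  qed
  also have "\<dots> = pr s (\<Union>b\<in>{1..nat \<lfloor>y\<rfloor>}. pair_cell y b)"
  proof (rule finite_measure_finite_Union[symmetric])
    show "disjoint_family_on (pair_cell y) {1..nat \<lfloor>y\<rfloor>}"
      unfolding disjoint_family_on_def pair_cell_def digit_eq_def by blast
  qed auto
  also have "\<dots> \<le> pr s (pair_ge y)"
  proof (rule pr_mono[OF s])
    show "(\<Union>b\<in>{1..nat \<lfloor>y\<rfloor>}. pair_cell y b) \<subseteq> pair_ge y"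
    proof
      fix x assume "x \<in> (\<Union>b\<in>{1..nat \<lfloor>y\<rfloor>}. pair_cell y b)"
      then obtain b where "b \<ge> 1" "x \<in> pair_cell y b" by auto
      then show "x \<in> pair_ge y" by (simp only: pair_cell_iff pair_ge_iff)
    qed
  qed simp
  finally show ?thesis by simp
next
  case False
  then have "ln y / (12 * y) \<le> 0" using y by (simp add: divide_nonpos_pos)
  then show ?thesis using measure_nonneg order_trans by blast
qed

subsection \<open>A conditional Borel-Cantelli lemma\<close>

lemma digit_determined_compl: "digit_determined d A \<Longrightarrow> digit_determined d (- A)"
  unfolding digit_determined_def Compl_iff by (meson borel_comp)

text \<open>The event \<open>C j\<close> is read from the j-th of consecutive digit blocks of
  lengths \<open>d j\<close>. Split off the first block as the past; the induction generalises over
  \<open>d\<close>, \<open>C\<close> and \<open>c\<close> because the remaining blocks are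
  re-indexed.\<close>

lemma pr_avoid_le:
  fixes d :: "nat \<Rightarrow> nat"
  assumes "\<And>j. digit_determined (d j) (C j)"
    and "\<And>j r. r \<in> {0..1} \<Longrightarrow> pr r (C j) \<le> c j" and "s \<in> {0..1}"
  shows "pr s (\<Inter>j<K. (gauss_map ^^ (\<Sum>i<j. d i)) -` C j) \<le> (\<Prod>j<K. c j)"
  using assms
proof (induction K arbitrary: d C c s)
  case 0
  then show ?case by (simp add: pr_UNIV)
next
  case (Suc K)
  let ?R = "\<Inter>j<K. (gauss_map ^^ (\<Sum>i<j. d (Suc i))) -` C (Suc j)"
  have C: "C j \<in> sets borel" for j using Suc.prems(1) by (simp add: digit_determined_def)
  have R: "?R \<in> sets borel"
    by (cases "K = 0") (auto intro!: sets.finite_INT vimage_funpow_measurable C)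
  have c: "0 \<le> c j" for j using Suc.prems(2)[of 0 j] order_trans[OF measure_nonneg] by auto
  have step: "(gauss_map ^^ (\<Sum>i<Suc j. d i)) x = (gauss_map ^^ (\<Sum>i<j. d (Suc i))) ((gauss_map ^^ d 0) x)" for x j
    unfolding sum.lessThan_Suc_shift by (subst add.commute) (simp add: funpow_add)
  have "(\<Inter>j<Suc K. (gauss_map ^^ (\<Sum>i<j. d i)) -` C j) = C 0 \<inter> (gauss_map ^^ d 0) -` ?R"
  proof (rule set_eqI)
    fix x
    have "x \<in> (\<Inter>j<Suc K. (gauss_map ^^ (\<Sum>i<j. d i)) -` C j) \<longleftrightarrow>
      (\<forall>j<Suc K. (gauss_map ^^ (\<Sum>i<j. d i)) x \<in> C j)"
      by blast
    also have "\<dots> \<longleftrightarrow> x \<in> C 0 \<and>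
      (\<forall>j<K. (gauss_map ^^ (\<Sum>i<j. d (Suc i))) ((gauss_map ^^ d 0) x) \<in> C (Suc j))"
      unfolding All_less_Suc2 step by simp
    finally show "x \<in> (\<Inter>j<Suc K. (gauss_map ^^ (\<Sum>i<j. d i)) -` C j) \<longleftrightarrow>
      x \<in> C 0 \<inter> (gauss_map ^^ d 0) -` ?R" by blast
  qed
  then have "pr s (\<Inter>j<Suc K. (gauss_map ^^ (\<Sum>i<j. d i)) -` C j) = pr s (C 0 \<inter> (gauss_map ^^ d 0) -` ?R)"
    by (rule arg_cong)
  also have "\<dots> \<le> pr s (C 0) * (\<Prod>j<K. c (Suc j))"
    by (intro pr_cylinder_le Suc.prems R Suc.IH)
  also have "\<dots> \<le> c 0 * (\<Prod>j<K. c (Suc j))"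
    by (intro mult_right_mono Suc.prems prod_nonneg c)
  finally show ?case unfolding prod.lessThan_Suc_shift .
qed

lemma not_summable_drop_initial:
  fixes r :: "nat \<Rightarrow> real"
  assumes "\<not> summable r"
  shows "\<not> summable (\<lambda>j. if j < J then 0 else r j)"
proof -
  have "eventually (\<lambda>j. (if j < J then 0 else r j) = r j) sequentially"
    by (rule eventually_sequentiallyI[of J]) auto
  then show ?thesis using assms by (simp only: summable_cong not_False_eq_True)
qed

text \<open>Lower bounds uniform in the parameter take the place of independence: missing all blocks
  from \<open>J\<close> to \<open>K\<close> has probability at most the product of the
  \<open>1 - r j\<close>, hence at most the exponential of minus their sum.\<close>

lemma conditional_borel_cantelli:
  fixes d :: "nat \<Rightarrow> nat"
  assumes det: "\<And>j. digit_determined (d j) (A j)"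
    and r: "\<And>j t. t \<in> {0..1} \<Longrightarrow> r j \<le> pr t (A j)" and r0: "\<And>j. 0 \<le> r j"
    and div: "\<not> summable r" and s: "s \<in> {0..1}"
  shows "AE x in cyl_law s. \<exists>\<^sub>\<infinity>j. (gauss_map ^^ (\<Sum>i<j. d i)) x \<in> A j"
proof -
  have A: "A j \<in> sets borel" for j using det by (simp add: digit_determined_def)
  define N where "N J = {x. \<forall>j\<ge>J. (gauss_map ^^ (\<Sum>i<j. d i)) x \<notin> A j}" for J
  have N: "N J \<in> sets borel" for J
  proof -
    have "N J = (\<Inter>j\<in>{J..}. - ((gauss_map ^^ (\<Sum>i<j. d i)) -` A j))" by (auto simp: N_def)
    also have "\<dots> \<in> sets borel"
      by (intro sets.countable_INT'' borel_comp vimage_funpow_measurable A) auto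
    finally show ?thesis .
  qed
  have N_null: "pr s (N J) = 0" for J
  proof (rule ccontr)
    assume "pr s (N J) \<noteq> 0"
    then have p: "pr s (N J) > 0" using measure_nonneg[of "cyl_law s" "N J"] by linarith
    \<comment> \<open>Blocks before \<open>J\<close> receive the trivial event and bound 0, so that
      \<open>pr_avoid_le\<close>, which starts at block 0, applies.\<close>
    define r' where "r' j = (if j < J then 0 else r j)" for j
    define C where "C j = (if j < J then UNIV else - A j)" for j
    have "digit_determined (d j) (C j)" for j
      unfolding C_def using det[of j] by (simp add: digit_determined_UNIV digit_determined_compl)
    moreover have "pr t (C j) \<le> 1 - r' j" if "t \<in> {0..1}" for t j
      using r[OF that, of j] by (simp add: C_def r'_def pr_UNIV[OF that] pr_compl[OF that A])
    ultimately have avoid: "pr s (\<Inter>j<K. (gauss_map ^^ (\<Sum>i<j. d i)) -` C j) \<le> (\<Prod>j<K. 1 - r' j)" for K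
      by (intro pr_avoid_le[of d C "\<lambda>j. 1 - r' j"] s)
    have C: "C j \<in> sets borel" for j using A by (auto simp: C_def)
    \<comment> \<open>If \<open>N J\<close> had positive measure, its logarithm would bound all
      partial sums, against divergence.\<close>
    have "(\<Sum>j<K. r' j) \<le> - ln (pr s (N J))" for K
    proof -
      have "pr s (N J) \<le> pr s (\<Inter>j<K. (gauss_map ^^ (\<Sum>i<j. d i)) -` C j)"
      proof (rule pr_mono[OF s])
        show "N J \<subseteq> (\<Inter>j<K. (gauss_map ^^ (\<Sum>i<j. d i)) -` C j)" by (auto simp: N_def C_def)
        show "(\<Inter>j<K. (gauss_map ^^ (\<Sum>i<j. d i)) -` C j) \<in> sets borel"
          by (cases "K = 0") (auto intro!: sets.finite_INT vimage_funpow_measurable C)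
      qed
      also have "\<dots> \<le> (\<Prod>j<K. 1 - r' j)" by (rule avoid)
      also have "\<dots> \<le> (\<Prod>j<K. exp (- r' j))"
      proof (rule prod_mono)
        fix j
        have "r' j \<le> 1" using r[OF s, of j] pr_le_1[OF s A[of j]] by (auto simp: r'_def)
        then show "0 \<le> 1 - r' j \<and> 1 - r' j \<le> exp (- r' j)" using exp_ge_add_one_self[of "- r' j"] by simp
      qed
      also have "\<dots> = exp (- (\<Sum>j<K. r' j))" unfolding sum_negf[symmetric] by (rule exp_sum[symmetric]) simp
      finally have "ln (pr s (N J)) \<le> - (\<Sum>j<K. r' j)" using p by (metis ln_exp ln_mono)
      then show ?thesis by simp
    qed
    then have "summable r'"
      by (intro summableI_nonneg_bounded) (auto simp: r'_def r0)
    then show False using not_summable_drop_initial[OF div, of J] by (simp add: r'_def[abs_def])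
  qed
  have "AE x in cyl_law s. x \<notin> N J" for J
    using N_null[of J] N[of J]
    by (intro AE_not_in) (simp add: null_sets_def emeasure_eq_pr[OF s])
  then have "AE x in cyl_law s. \<forall>J. x \<notin> N J" by (simp add: AE_all_countable)
  then show ?thesis
    by (rule eventually_mono) (auto simp: N_def INFM_nat_le)
qed

section \<open>Irrational orbits and positivity of their digits\<close>

lemma AE_irrational: "AE x in cyl_law s. x \<in> {0<..<1} - \<rat>"
proof -
  have "AE x in lborel. x \<notin> (\<rat> :: real set)"
    by (intro AE_not_in countable_imp_null_set_lborel countable_rat)
  then have "AE x in cyl_law s. x \<notin> \<rat>"
    unfolding cyl_law_def by (subst AE_density) (measurable, erule eventually_mono, blast)
  with AE_cyl_law[of s] show ?thesis by eventually_elim blast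
qed

lemma gauss_map_irrational:
  assumes "x \<in> {0<..<1} - \<rat>"
  shows "gauss_map x \<in> {0<..<1} - \<rat>"
proof -
  have "1 / x \<notin> \<rat>" using assms Rats_divide[of 1 "1 / x"] by auto
  then have frac: "frac (1 / x) \<notin> \<rat>"
    unfolding frac_def using Rats_add[of "1 / x - of_int \<lfloor>1 / x\<rfloor>" "of_int \<lfloor>1 / x\<rfloor>"] by auto
  then have "frac (1 / x) \<noteq> 0" by (metis Rats_0)
  then have "frac (1 / x) > 0" using frac_ge_0[of "1 / x"] by linarith
  then show ?thesis using frac frac_lt_1[of "1 / x"] assms by (simp add: gauss_map_def)
qed

lemma funpow_gauss_map_irrational:
  "x \<in> {0<..<1} - \<rat> \<Longrightarrow> (gauss_map ^^ n) x \<in> {0<..<1} - \<rat>"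
proof (induction n)
  case (Suc n)
  then show ?case using gauss_map_irrational[OF Suc.IH] by simp
qed simp

lemma partial_quotient_pos:
  assumes "x \<in> {0<..<1} - \<rat>"
  shows "partial_quotient n x \<ge> 1"
proof -
  have "(gauss_map ^^ (n - 1)) x \<in> {0<..<1}" using funpow_gauss_map_irrational[OF assms] by blast
  then have "1 \<le> 1 / (gauss_map ^^ (n - 1)) x" by simp
  then have "1 \<le> \<lfloor>1 / (gauss_map ^^ (n - 1)) x\<rfloor>" by (simp only: one_le_floor)
  then show ?thesis unfolding partial_quotient_def by (simp only: nat_1[symmetric] nat_mono)
qed

section \<open>Blocks of disjoint digit pairs\<close>

lemma vimage_pair_ge:
  "(gauss_map ^^ m) x \<in> pair_ge y \<longleftrightarrow>
    y \<le> real (partial_quotient (m + 1) x * partial_quotient (m + 2) x)"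
  unfolding pair_ge_def by (simp add: partial_quotient_shift)

text \<open>Only every second starting position is used, so that the pairs share no digit.\<close>
definition pair_block :: "nat \<Rightarrow> real \<Rightarrow> real set" where
  "pair_block M y = {x. \<exists>i<M. (gauss_map ^^ (2 * i)) x \<in> pair_ge y}"

lemma pair_block_sets: "pair_block M y \<in> sets borel"
proof -
  have "pair_block M y = (\<Union>i<M. (gauss_map ^^ (2 * i)) -` pair_ge y)" by (auto simp: pair_block_def)
  also have "\<dots> \<in> sets borel" by (intro sets.finite_UN vimage_funpow_measurable pair_ge_sets) auto
  finally show ?thesis .
qed

text \<open>Pair \<open>i\<close> of a half-block reads its digits 2i + 1 and 2i + 2 with
  \<open>i < M\<close>, so the two halves together read 4M digits.\<close>

lemma double_block_determined:
  "digit_determined (4 * M) (pair_block M y \<inter> (gauss_map ^^ (2 * M)) -` pair_block M y)"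
proof (rule digit_determinedI)
  show "pair_block M y \<inter> (gauss_map ^^ (2 * M)) -` pair_block M y \<in> sets borel"
    using pair_block_sets vimage_funpow_measurable by blast
next
  fix x x' :: real
  assume eq: "\<And>i. 1 \<le> i \<Longrightarrow> i \<le> 4 * M \<Longrightarrow> partial_quotient i x = partial_quotient i x'"
    and x: "x \<in> pair_block M y \<inter> (gauss_map ^^ (2 * M)) -` pair_block M y"
  have shift: "(gauss_map ^^ (2 * i)) ((gauss_map ^^ (2 * M)) z) = (gauss_map ^^ (2 * i + 2 * M)) z" for i z
    by (simp add: funpow_add)
  from x obtain i j where "i < M" "j < M" "(gauss_map ^^ (2 * i)) x \<in> pair_ge y"
    "(gauss_map ^^ (2 * j + 2 * M)) x \<in> pair_ge y"
    by (auto simp: pair_block_def shift)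
  then have "i < M" "j < M" "(gauss_map ^^ (2 * i)) x' \<in> pair_ge y"
    "(gauss_map ^^ (2 * j + 2 * M)) x' \<in> pair_ge y"
    unfolding vimage_pair_ge using eq by auto
  then show "x' \<in> pair_block M y \<inter> (gauss_map ^^ (2 * M)) -` pair_block M y"
    by (auto simp: pair_block_def shift)
qed

text \<open>All M pairs fail with probability at most (1 - q)^M. By Bernoulli's inequality (1 - q)^M
  (1 + M q) \<le> (1 - q^2)^M \<le> 1, which gives a bound useful for small and large M q
  alike.\<close>

lemma pr_pair_block_ge:
  assumes s: "s \<in> {0..1}" and q: "\<And>r. r \<in> {0..1} \<Longrightarrow> q \<le> pr r (pair_ge y)" "0 \<le> q"
  shows "M * q / (1 + M * q) \<le> pr s (pair_block M y)"
proof -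
  have q1: "q \<le> 1" using q(1)[OF s] pr_le_1[OF s pair_ge_sets] order_trans by blast
  have "digit_determined 2 (- pair_ge y)"
    by (rule digit_determined_compl[OF pair_ge_determined])
  moreover have "pr r (- pair_ge y) \<le> 1 - q" if "r \<in> {0..1}" for r
    using q(1)[OF that] by (simp add: pr_compl[OF that])
  ultimately have "pr s (\<Inter>j<M. (gauss_map ^^ (\<Sum>i<j. 2)) -` (- pair_ge y)) \<le> (\<Prod>j<M. 1 - q)"
    by (intro pr_avoid_le[of "\<lambda>_. 2" "\<lambda>_. - pair_ge y" "\<lambda>_. 1 - q"] s)
  moreover have "(\<Inter>j<M. (gauss_map ^^ (\<Sum>i<j. 2)) -` (- pair_ge y)) = - pair_block M y"
    unfolding pair_block_def by (auto simp: mult.commute[of _ 2])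
  ultimately have 1: "1 - pr s (pair_block M y) \<le> (1 - q) ^ M"
    by (simp add: pr_compl[OF s pair_block_sets])
  have pos: "1 + M * q > 0" using q(2) by (intro add_pos_nonneg) auto
  have "(1 - q) ^ M * (1 + M * q) \<le> (1 - q) ^ M * (1 + q) ^ M"
    using q(2) q1 Bernoulli_inequality[of q M] by (intro mult_left_mono) auto
  also have "\<dots> = (1 - q * q) ^ M"
    unfolding power_mult_distrib[symmetric] by (simp add: algebra_simps)
  also have "\<dots> \<le> 1"
    using mult_le_one[OF q1 q(2) q1] q(2) by (intro power_le_one) simp_all
  finally have "(1 - q) ^ M \<le> 1 / (1 + M * q)" using pos by (simp only: pos_le_divide_eq)
  moreover have "1 - 1 / (1 + M * q) = M * q / (1 + M * q)"
    using pos by (simp add: divide_simps)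
  ultimately show ?thesis using 1 by linarith
qed

lemma pr_double_block_ge:
  assumes s: "s \<in> {0..1}" and q: "\<And>r. r \<in> {0..1} \<Longrightarrow> q \<le> pr r (pair_ge y)" "0 \<le> q"
  shows "(M * q / (1 + M * q))\<^sup>2 \<le> pr s (pair_block M y \<inter> (gauss_map ^^ (2 * M)) -` pair_block M y)"
proof -
  let ?c = "M * q / (1 + M * q)"
  have c: "?c \<ge> 0" using q by simp
  have det: "digit_determined (2 * M) (pair_block M y)"
  proof (rule digit_determinedI[OF pair_block_sets])
    fix x x' :: real
    assume eq: "\<And>i. 1 \<le> i \<Longrightarrow> i \<le> 2 * M \<Longrightarrow> partial_quotient i x = partial_quotient i x'"
      and x: "x \<in> pair_block M y"
    then show "x' \<in> pair_block M y" unfolding pair_block_def vimage_pair_ge by auto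
  qed
  have "?c\<^sup>2 \<le> pr s (pair_block M y) * ?c"
    unfolding power2_eq_square using q c by (intro mult_right_mono pr_pair_block_ge s) auto
  also have "\<dots> \<le> pr s (pair_block M y \<inter> (gauss_map ^^ (2 * M)) -` pair_block M y)"
    using q c by (intro pr_cylinder_ge[OF det pair_block_sets] pr_pair_block_ge s) auto
  finally show ?thesis .
qed

subsection \<open>The convergence case\<close>

text \<open>Positions count iterates from 0, so iterate \<open>n\<close> carries the product with
  index n + 1; accordingly the level inserted later is \<open>\<phi> (Suc n)\<close>.\<close>

definition late_pair :: "real \<Rightarrow> nat \<Rightarrow> real set" where
  "late_pair y n = (\<Union>m<n. (gauss_map ^^ m) -` pair_ge y \<inter> (gauss_map ^^ n) -` pair_ge y)"

lemma late_pair_sets: "late_pair y n \<in> sets borel"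
  unfolding late_pair_def
  by (intro sets.finite_UN sets.Int vimage_funpow_measurable pair_ge_sets) auto

text \<open>At distance at least 2 the pairs share no digit: the two digits of the earlier pair form
  the past, and the later pair is a shifted future event.\<close>

lemma pr_separated_pairs_le:
  assumes s: "s \<in> {0..1}" and y: "y \<ge> 1"
  shows "pr s ((gauss_map ^^ m) -` pair_ge y \<inter> (gauss_map ^^ (m + (2 + e))) -` pair_ge y) \<le>
    ((6 + 4 * ln y) / y)\<^sup>2"
proof -
  let ?q = "(6 + 4 * ln y) / y"
  let ?B = "(gauss_map ^^ e) -` pair_ge y"
  have q: "?q \<ge> 0" using y by simp
  have B: "?B \<in> sets borel" by (intro vimage_funpow_measurable pair_ge_sets)
  have AB: "pair_ge y \<inter> (gauss_map ^^ 2) -` ?B \<in> sets borel"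
    by (intro sets.Int vimage_funpow_measurable B pair_ge_sets)
  have "pr r (pair_ge y \<inter> (gauss_map ^^ 2) -` ?B) \<le> ?q\<^sup>2" if r: "r \<in> {0..1}" for r
  proof -
    have "pr r (pair_ge y \<inter> (gauss_map ^^ 2) -` ?B) \<le> pr r (pair_ge y) * ?q"
      by (intro pr_cylinder_le[OF pair_ge_determined B] pr_vimage_le pair_ge_sets pr_pair_ge_le r y)
    also have "\<dots> \<le> ?q * ?q" by (intro mult_right_mono pr_pair_ge_le r y q)
    finally show ?thesis by (simp only: power2_eq_square)
  qed
  then have "pr s ((gauss_map ^^ m) -` (pair_ge y \<inter> (gauss_map ^^ 2) -` ?B)) \<le> ?q\<^sup>2"
    by (intro pr_vimage_le AB s)
  moreover have "(gauss_map ^^ m) -` (pair_ge y \<inter> (gauss_map ^^ 2) -` ?B) =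
    (gauss_map ^^ m) -` pair_ge y \<inter> (gauss_map ^^ (m + (2 + e))) -` pair_ge y"
  proof -
    have "(gauss_map ^^ (m + (2 + e))) x = (gauss_map ^^ e) ((gauss_map ^^ 2) ((gauss_map ^^ m) x))" for x
      by (simp only: add.commute[of m] add.commute[of 2 e] funpow_add o_apply)
    then show ?thesis by auto
  qed
  ultimately show ?thesis by simp
qed

text \<open>Only the position just before \<open>n\<close> overlaps with the late pair and gives 10
  / y; all others are separated.\<close>

lemma pr_late_pair_le:
  assumes s: "s \<in> {0..1}" and y: "y \<ge> 1"
  shows "pr s (late_pair y n) \<le> 10 / y + real n * ((6 + 4 * ln y) / y)\<^sup>2"
proof (cases n)
  case 0
  then show ?thesis using y by (simp add: late_pair_def)
next
  case (Suc N)
  let ?q = "(6 + 4 * ln y) / y"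
  let ?B = "\<lambda>m. (gauss_map ^^ m) -` pair_ge y \<inter> (gauss_map ^^ n) -` pair_ge y"
  have B: "?B m \<in> sets borel" for m
    by (intro sets.Int vimage_funpow_measurable pair_ge_sets)
  have "?B N = (gauss_map ^^ N) -` (pair_ge y \<inter> (gauss_map ^^ 1) -` pair_ge y)"
    using Suc by auto
  also have "pr s \<dots> \<le> 10 / y"
    by (intro pr_vimage_le sets.Int vimage_funpow_measurable pair_ge_sets pr_adjacent_pairs_le s y)
  finally have "pr s (?B N) \<le> 10 / y" .
  moreover have "(\<Sum>m<N. pr s (?B m)) \<le> (\<Sum>m<N. ?q\<^sup>2)"
  proof (rule sum_mono)
    fix m assume "m \<in> {..<N}"
    then obtain e where "n = m + (2 + e)" using Suc less_imp_Suc_add[of m N] by auto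
    then show "pr s (?B m) \<le> ?q\<^sup>2" using pr_separated_pairs_le[OF s y, of m e] by simp
  qed
  moreover have "(\<Sum>m<N. ?q\<^sup>2) \<le> real n * ?q\<^sup>2"
    unfolding sum_constant using Suc by (intro mult_right_mono) auto
  moreover have "pr s (late_pair y n) \<le> pr s (?B N) + (\<Sum>m<N. pr s (?B m))"
    by (rule pr_union_le[OF s _ B B]) (auto simp: late_pair_def Suc less_Suc_eq)
  ultimately show ?thesis by linarith
qed

text \<open>From \<open>y \<ge> exp 1\<close> follows \<open>ln y \<ge> 1\<close>, so 6 + 4 ln y
  \<le> 10 ln y, and squaring gives the factor 100.\<close>

lemma pr_late_pair_le_term:
  assumes s: "s \<in> {0..1}" and y: "y \<ge> exp 1"
  shows "pr s (late_pair y n) \<le> 100 * ((y + real (Suc n) * (ln y)\<^sup>2) / y\<^sup>2)"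
proof -
  have y1: "y \<ge> 1" using y exp_ge_add_one_self[of 1] by linarith
  have l: "ln y \<ge> 1" using y y1 by (metis exp_gt_zero ln_exp ln_mono)
  have "(6 + 4 * ln y)\<^sup>2 \<le> (10 * ln y)\<^sup>2" using l by (intro power_mono) auto
  then have "((6 + 4 * ln y) / y)\<^sup>2 \<le> 100 * ((ln y)\<^sup>2 / y\<^sup>2)"
    unfolding power_divide by (simp add: power_mult_distrib divide_right_mono)
  then have "real n * ((6 + 4 * ln y) / y)\<^sup>2 \<le> real (Suc n) * (100 * ((ln y)\<^sup>2 / y\<^sup>2))"
    by (intro mult_mono) auto
  moreover have "10 / y \<le> 100 * (y / y\<^sup>2)" using y1 by (simp add: power2_eq_square divide_right_mono)
  moreover have "100 * ((y + real (Suc n) * (ln y)\<^sup>2) / y\<^sup>2) =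
    100 * (y / y\<^sup>2) + real (Suc n) * (100 * ((ln y)\<^sup>2 / y\<^sup>2))"
    by (simp add: add_divide_distrib algebra_simps)
  ultimately show ?thesis using pr_late_pair_le[OF s y1, of n] by linarith
qed

section \<open>The limsup set in terms of the orbit, its measurability and its measure\<close>

lemma F2_iff:
  "x \<in> F2 \<phi> \<longleftrightarrow> x \<in> {0<..<1} - \<rat> \<and> (\<exists>\<^sub>\<infinity>n. \<exists>k<n. \<exists>l<n. k \<noteq> l \<and>
      (gauss_map ^^ k) x \<in> pair_ge (\<phi> n) \<and> (gauss_map ^^ l) x \<in> pair_ge (\<phi> n))"
proof -
  \<comment> \<open>Indices 1 to n become iterate counts 0 to n - 1.\<close>
  have ex: "(\<exists>k\<in>{1..n}. P k) \<longleftrightarrow> (\<exists>k<n. P (Suc k))" for P :: "nat \<Rightarrow> bool" and n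
    by (metis One_nat_def Suc_le_D Suc_le_eq atLeastAtMost_iff le0 Suc_le_mono)
  have "x \<in> {0..<1} - \<rat> \<longleftrightarrow> x \<in> {0<..<1} - \<rat>"
    by (cases "x = 0") auto
  then show ?thesis unfolding F2_def mem_Collect_eq ex vimage_pair_ge by simp
qed

lemma F2_sets: "F2 \<phi> \<in> sets borel"
proof -
  define S where "S n = (\<Union>k<n. \<Union>l\<in>{l. l < n \<and> k \<noteq> l}.
      (gauss_map ^^ k) -` pair_ge (\<phi> n) \<inter> (gauss_map ^^ l) -` pair_ge (\<phi> n))" for n
  have S: "x \<in> S n \<longleftrightarrow> (\<exists>k<n. \<exists>l<n. k \<noteq> l \<and> (gauss_map ^^ k) x \<in> pair_ge (\<phi> n) \<and>
      (gauss_map ^^ l) x \<in> pair_ge (\<phi> n))" for x n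
    unfolding S_def by blast
  have "F2 \<phi> = ({0<..<1} - \<rat>) \<inter> (\<Inter>m. \<Union>n\<in>{m..}. S n)"
  proof (rule set_eqI)
    fix x
    show "x \<in> F2 \<phi> \<longleftrightarrow> x \<in> ({0<..<1} - \<rat>) \<inter> (\<Inter>m. \<Union>n\<in>{m..}. S n)"
      unfolding F2_iff S[symmetric] INFM_nat_le by (simp add: Bex_def)
  qed
  also have "\<dots> \<in> sets borel"
  proof -
    have "S n \<in> sets borel" for n
      unfolding S_def by (intro sets.finite_UN sets.Int vimage_funpow_measurable pair_ge_sets) auto
    then have "(\<Inter>m. \<Union>n\<in>{m..}. S n) \<in> sets borel"
      by (intro sets.countable_INT'' sets.countable_UN'') auto
    moreover have "\<rat> \<in> sets (borel :: real measure)"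
      by (rule sets.countable[OF _ countable_rat]) auto
    ultimately show ?thesis by (intro sets.Int sets.Diff) auto
  qed
  finally show ?thesis .
qed

text \<open>For s = 0 the density is constantly 1, so \<open>cyl_law 0\<close> is Lebesgue measure
  on the unit interval.\<close>

lemma emeasure_lebesgue_F2: "emeasure lebesgue (F2 \<phi>) = emeasure (cyl_law 0) (F2 \<phi>)"
proof -
  have "emeasure (cyl_law 0) (F2 \<phi>) = (\<integral>\<^sup>+x. indicator (F2 \<phi>) x \<partial>lborel)"
    unfolding emeasure_cyl_law[OF F2_sets]
    by (intro nn_integral_cong) (auto simp: cyl_dens_def F2_iff indicator_def)
  then show ?thesis using F2_sets[of \<phi>] by simp
qed

lemma filterlim_at_top_of_summable_inverse:
  fixes f :: "nat \<Rightarrow> real"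
  assumes "summable (\<lambda>n. 1 / f n)" "\<And>n. f n > 0"
  shows "filterlim f at_top sequentially"
proof -
  have "filterlim (\<lambda>n. inverse (1 / f n)) at_top sequentially"
    using assms by (intro filterlim_inverse_at_top summable_LIMSEQ_zero) auto
  then show ?thesis by simp
qed

text \<open>If \<open>k < l \<le> n\<close> witness the condition for \<open>n\<close>, they witness it for \<open>l\<close>, by monotonicity; and a
  fixed \<open>l\<close> serves only finitely many \<open>n\<close> because \<open>\<phi>\<close> tends to infinity.\<close>
lemma F2_subset_late_pair:
  assumes mono: "mono_on {1..} \<phi>" and lim: "filterlim (\<lambda>n. \<phi> (Suc n)) at_top sequentially"
    and x: "x \<in> F2 \<phi>"
  shows "\<exists>\<^sub>\<infinity>n. x \<in> late_pair (\<phi> (Suc n)) n"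
proof (rule ccontr)
  assume "\<not> ?thesis"
  then obtain L where L: "\<And>n. n \<ge> L \<Longrightarrow> x \<notin> late_pair (\<phi> (Suc n)) n"
    by (auto simp: INFM_nat_le)
  define c where "c l = real (partial_quotient (l + 1) x * partial_quotient (l + 2) x)" for l
  define C where "C = Max (c ` {..L})"
  from lim obtain n0 where n0: "\<And>n. n \<ge> n0 \<Longrightarrow> C + 1 \<le> \<phi> (Suc n)"
    unfolding filterlim_at_top eventually_sequentially by meson
  from x obtain n k l where n: "n \<ge> Suc n0" and kl: "k < n" "l < n" "k \<noteq> l"
    "(gauss_map ^^ k) x \<in> pair_ge (\<phi> n)" "(gauss_map ^^ l) x \<in> pair_ge (\<phi> n)"
    unfolding F2_iff INFM_nat_le by blast
  obtain k' l' where kl': "k' < l'" "l' < n"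
    "(gauss_map ^^ k') x \<in> pair_ge (\<phi> n)" "(gauss_map ^^ l') x \<in> pair_ge (\<phi> n)"
    using kl by (metis nat_neq_iff)
  have "\<phi> (Suc l') \<le> \<phi> n" using kl' by (intro mono_onD[OF mono]) auto
  then have "x \<in> late_pair (\<phi> (Suc l')) l'"
    using kl' unfolding late_pair_def pair_ge_def by fastforce
  then have "l' < L" using L not_le by blast
  then have "c l' \<le> C" unfolding C_def by (intro Max_ge) auto
  moreover have "\<phi> n \<le> c l'" using kl'(4) unfolding vimage_pair_ge c_def .
  moreover have "C + 1 \<le> \<phi> n" using n0[of "n - 1"] n by simp
  ultimately show False by simp
qed

lemma F2_null:
  assumes pos: "\<And>n. n \<ge> 1 \<Longrightarrow> \<phi> n > 0" and mono: "mono_on {1..} \<phi>"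
    and sum: "summable (\<lambda>n. (\<phi> (Suc n) + real (Suc n) * (ln (\<phi> (Suc n)))\<^sup>2) / (\<phi> (Suc n))\<^sup>2)" (is "summable ?s")
  shows "emeasure (cyl_law 0) (F2 \<phi>) = 0"
proof -
  have z: "(0::real) \<in> {0..1}" by simp
  \<comment> \<open>The given terms dominate 1 / \<phi>; hence \<phi> tends to infinity and
    eventually exceeds e, as the term bound requires.\<close>
  have "summable (\<lambda>n. 1 / \<phi> (Suc n))"
  proof (rule summable_comparison_test'[OF sum])
    fix n
    have p: "\<phi> (Suc n) > 0" using pos by simp
    have "1 / \<phi> (Suc n) = \<phi> (Suc n) / (\<phi> (Suc n))\<^sup>2" using p by (simp add: power2_eq_square)
    also have "\<dots> \<le> ?s n" by (intro divide_right_mono) auto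
    finally show "norm (1 / \<phi> (Suc n)) \<le> ?s n" using p by simp
  qed
  then have lim: "filterlim (\<lambda>n. \<phi> (Suc n)) at_top sequentially"
    using pos by (intro filterlim_at_top_of_summable_inverse) auto
  then have "eventually (\<lambda>n. exp 1 \<le> \<phi> (Suc n)) sequentially"
    unfolding filterlim_at_top by blast
  then have "eventually (\<lambda>n. norm (pr 0 (late_pair (\<phi> (Suc n)) n)) \<le> 100 * ?s n) sequentially"
    by eventually_elim (use pr_late_pair_le_term[OF z] in simp)
  then have "summable (\<lambda>n. pr 0 (late_pair (\<phi> (Suc n)) n))"
    by (rule summable_comparison_test_ev) (intro summable_mult sum)
  then have "AE x in cyl_law 0. eventually (\<lambda>n. x \<in> space (cyl_law 0) - late_pair (\<phi> (Suc n)) n) sequentially"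
    by (intro borel_cantelli_AE1) (simp_all add: late_pair_sets emeasure_eq_pr)
  then have "AE x in cyl_law 0. x \<notin> F2 \<phi>"
  proof (rule eventually_mono)
    fix x assume "eventually (\<lambda>n. x \<in> space (cyl_law 0) - late_pair (\<phi> (Suc n)) n) sequentially"
    then have "\<not> (\<exists>\<^sub>\<infinity>n. x \<in> late_pair (\<phi> (Suc n)) n)"
      by (simp add: frequently_def cofinite_eq_sequentially)
    then show "x \<notin> F2 \<phi>" using F2_subset_late_pair[OF mono lim] by blast
  qed
  then show ?thesis
    using F2_sets[of \<phi>] by (subst (asm) AE_iff_measurable[of "F2 \<phi>"]) auto
qed

subsection \<open>The divergence case\<close>

lemma AE_F2_digits:
  assumes pos: "\<And>n. n \<ge> 1 \<Longrightarrow> \<phi> n > 0"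
    and div: "\<not> summable (\<lambda>n. 1 / \<phi> (Suc n))"
  shows "AE x in cyl_law 0. x \<in> F2 \<phi>"
proof -
  define r where "r n = 1 / (\<phi> (Suc n) + 1)" for n
  have p: "\<phi> (Suc n) > 0" for n using pos by simp
  \<comment> \<open>Summability of \<open>r\<close> would force \<phi> \<ge> 1 eventually, and then
    1 / \<phi> \<le> 2 / (\<phi> + 1) would transfer convergence.\<close>
  have "\<not> summable r"
  proof
    assume r: "summable r"
    have "filterlim (\<lambda>n. \<phi> (Suc n) + 1) at_top sequentially"
      using r p unfolding r_def by (intro filterlim_at_top_of_summable_inverse) (auto intro: add_pos_pos)
    then have "eventually (\<lambda>n. 2 \<le> \<phi> (Suc n) + 1) sequentially"
      unfolding filterlim_at_top by blast
    then have "eventually (\<lambda>n. norm (1 / \<phi> (Suc n)) \<le> 2 * r n) sequentially"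
    proof eventually_elim
      case (elim n)
      then show ?case unfolding r_def using p[of n] by (simp add: field_simps)
    qed
    then have "summable (\<lambda>n. 1 / \<phi> (Suc n))"
      by (rule summable_comparison_test_ev) (intro summable_mult r)
    then show False using div by simp
  qed
  moreover have "r j \<le> pr t (digit_ge (\<phi> (Suc j)))" if "t \<in> {0..1}" for t j
    unfolding r_def by (rule pr_digit_ge_ge[OF that p])
  moreover have "0 \<le> r j" for j unfolding r_def using p[of j] by simp
  ultimately have "AE x in cyl_law 0. \<exists>\<^sub>\<infinity>j. (gauss_map ^^ (\<Sum>i<j. 1)) x \<in> digit_ge (\<phi> (Suc j))"
    by (intro conditional_borel_cantelli[of "\<lambda>_. 1" "\<lambda>j. digit_ge (\<phi> (Suc j))" r] digit_ge_determined) auto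
  with AE_irrational[of 0] show ?thesis
  proof eventually_elim
    fix x assume x: "x \<in> {0<..<1} - \<rat>"
      and inf: "\<exists>\<^sub>\<infinity>j. (gauss_map ^^ (\<Sum>i<j. 1)) x \<in> digit_ge (\<phi> (Suc j))"
    have "\<exists>n\<ge>m. \<exists>k<n. \<exists>l<n. k \<noteq> l \<and> (gauss_map ^^ k) x \<in> pair_ge (\<phi> n) \<and>
        (gauss_map ^^ l) x \<in> pair_ge (\<phi> n)" for m
    proof -
      from inf obtain j where j: "j \<ge> Suc m" "(gauss_map ^^ (\<Sum>i<j. 1)) x \<in> digit_ge (\<phi> (Suc j))"
        unfolding INFM_nat_le by blast
      \<comment> \<open>The large digit has index j + 1. It is the first digit of the pair at
        \<open>j\<close> and the second of the pair at \<open>i\<close>, and its neighbours are at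
        least 1; \<open>j \<ge> Suc m\<close> ensures that \<open>i\<close> exists.\<close>
      obtain i where i: "j = Suc i" using j(1) by (cases j) auto
      have ge: "\<phi> (Suc j) \<le> real (partial_quotient (j + 1) x)"
        using j(2) by (simp add: digit_ge_def partial_quotient_shift)
      also have "\<dots> \<le> real (partial_quotient (j + 1) x * partial_quotient (j + 2) x)"
        using partial_quotient_pos[OF x, of "j + 2"] by (intro of_nat_mono) simp
      finally have 1: "(gauss_map ^^ j) x \<in> pair_ge (\<phi> (Suc j))"
        unfolding vimage_pair_ge .
      have "\<phi> (Suc j) \<le> real (partial_quotient (i + 2) x)"
        using ge i by simp
      also have "\<dots> \<le> real (partial_quotient (i + 1) x * partial_quotient (i + 2) x)"
        using partial_quotient_pos[OF x, of "i + 1"] by (intro of_nat_mono) simp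
      finally have 2: "(gauss_map ^^ i) x \<in> pair_ge (\<phi> (Suc j))"
        unfolding vimage_pair_ge .
      have "i < Suc j" "j < Suc j" "i \<noteq> j" "Suc j \<ge> m" using i j(1) by simp_all
      then show ?thesis using 1 2 by blast
    qed
    then show "x \<in> F2 \<phi>" using x unfolding F2_iff INFM_nat_le by blast
  qed
qed

text \<open>One half of Cauchy condensation. Block bounds are asked only from \<open>J\<close> on,
  since in the application monotonicity holds only eventually.\<close>

lemma summable_of_dyadic_blocks:
  fixes h v :: "nat \<Rightarrow> real"
  assumes h: "\<And>n. h n \<ge> 0" and v: "summable v" "\<And>j. v j \<ge> 0"
    and block: "\<And>j. j \<ge> J \<Longrightarrow> (\<Sum>n\<in>{2 ^ j..<2 ^ Suc j}. h n) \<le> v j"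
  shows "summable h"
proof (rule summableI_nonneg_bounded[OF h])
  fix n
  have split: "(\<Sum>i<2 ^ (J + K). h i) \<le> (\<Sum>i<2 ^ J. h i) + (\<Sum>j<K. v (J + j))" for K
  proof (induction K)
    case (Suc K)
    have "(\<Sum>i<2 ^ Suc (J + K). h i) = (\<Sum>i<2 ^ (J + K). h i) + (\<Sum>i\<in>{2 ^ (J + K)..<2 ^ Suc (J + K)}. h i)"
      unfolding lessThan_atLeast0 by (rule sum.atLeastLessThan_concat[symmetric]) simp_all
    moreover have "(\<Sum>j<Suc K. v (J + j)) = (\<Sum>j<K. v (J + j)) + v (J + K)" by simp
    ultimately show ?case using Suc.IH block[of "J + K"] unfolding add_Suc_right by linarith
  qed simp
  have "n < 2 ^ n" by simp
  also have "\<dots> \<le> (2::nat) ^ (J + n)" by (intro power_increasing) auto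
  finally have "(\<Sum>i<n. h i) \<le> (\<Sum>i<2 ^ (J + n). h i)"
    by (intro sum_mono2) (auto simp: h)
  moreover have "(\<Sum>j<n. v (J + j)) \<le> (\<Sum>j. v (J + j))"
  proof (rule sum_le_suminf)
    show "summable (\<lambda>j. v (J + j))"
      using summable_ignore_initial_segment[OF v(1), of J] by (simp only: add.commute)
  qed (simp_all add: v(2))
  ultimately show "(\<Sum>i<n. h i) \<le> (\<Sum>i<2 ^ J. h i) + (\<Sum>j. v (J + j))"
    using split[of n] by linarith
qed

text \<open>Put x = 2^j q j. Summability would give x < 1 eventually, so x \<le> 2 x / (1 + x) and
  the x^2 would be summable. Because ln t / t decreases for t \<ge> e, condensation would then make
  the original series converge.\<close>

lemma dyadic_not_summable:
  assumes mono: "mono_on {1..} \<phi>" and lim: "filterlim (\<lambda>n. \<phi> (Suc n)) at_top sequentially"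
    and div: "\<not> summable (\<lambda>n. real (Suc n) * (ln (\<phi> (Suc n)) / \<phi> (Suc n))\<^sup>2)"
    and q: "\<And>j. q j = max 0 (ln (\<phi> (2 ^ (j + 3))) / (12 * \<phi> (2 ^ (j + 3))))"
  shows "\<not> summable (\<lambda>j. (2 ^ j * q j / (1 + 2 ^ j * q j))\<^sup>2)" (is "\<not> summable ?r")
proof
  assume r: "summable ?r"
  define g where "g n = ln (\<phi> n) / \<phi> n" for n
  define v where "v j = (2 ^ j * g (2 ^ j))\<^sup>2" for j
  from lim obtain n1 where n1: "\<And>n. n \<ge> n1 \<Longrightarrow> exp 1 \<le> \<phi> (Suc n)"
    unfolding filterlim_at_top eventually_sequentially by meson
  have n0: "exp 1 \<le> \<phi> n" if "n \<ge> Suc n1" for n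
    using n1[of "n - 1"] that by simp
  have g_nonneg: "g n \<ge> 0" if "n \<ge> Suc n1" for n
  proof -
    have "\<phi> n \<ge> 1" using n0[OF that] exp_ge_add_one_self[of 1] by linarith
    then show ?thesis by (simp add: g_def)
  qed
  have g_mono: "g n \<le> g m" if "m \<ge> Suc n1" "m \<le> n" for m n
    unfolding g_def using that by (intro ln_x_over_x_mono n0 mono_onD[OF mono]) auto
  have big: "Suc n1 \<le> 2 ^ j" if "j \<ge> Suc n1" for j
    using that less_exp[of j] by linarith
  have "?r \<longlonglongrightarrow> 0" by (rule summable_LIMSEQ_zero[OF r])
  then have "eventually (\<lambda>j. ?r j < (1 / 2)\<^sup>2) sequentially"
    by (rule order_tendstoD(2)) simp
  \<comment> \<open>Here 36864 = 4 * 96^2, where 96 = 8 * 12: the 8 comes from 2^(j + 3), the 12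
    from \<open>q\<close>, and the 4 from squaring x \<le> 2 x / (1 + x).\<close>
  then have "eventually (\<lambda>j. norm (v (j + 3)) \<le> 36864 * ?r j) sequentially"
    using eventually_ge_at_top[of "Suc n1"]
  proof eventually_elim
    fix j assume small: "?r j < (1 / 2)\<^sup>2" and j: "Suc n1 \<le> j"
    define x where "x = 2 ^ j * q j"
    have x0: "x \<ge> 0" by (simp add: x_def q)
    have "x / (1 + x) < 1 / 2"
      using small unfolding x_def[symmetric] by (rule power_less_imp_less_base) simp
    then have "x < 1" using x0 by (simp add: field_simps)
    then have "x * (1 + x) \<le> x * 2" using x0 by (intro mult_left_mono) auto
    then have "x \<le> 2 * (x / (1 + x))" using x0 by (simp add: field_simps)
    then have "x\<^sup>2 \<le> (2 * (x / (1 + x)))\<^sup>2" using x0 by (intro power_mono) auto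
    then have x2: "x\<^sup>2 \<le> 4 * ?r j" by (simp add: x_def power_mult_distrib power_divide)
    have "0 \<le> g (2 ^ (j + 3))" using j by (intro g_nonneg big) simp
    moreover have "ln (\<phi> (2 ^ (j + 3))) / (12 * \<phi> (2 ^ (j + 3))) = g (2 ^ (j + 3)) / 12"
      by (simp add: g_def)
    ultimately have "q j = g (2 ^ (j + 3)) / 12" unfolding q by simp
    then have "2 ^ (j + 3) * g (2 ^ (j + 3)) = 96 * x" by (simp add: x_def power_add)
    then have "v (j + 3) = 9216 * x\<^sup>2" unfolding v_def by (simp add: power_mult_distrib)
    then show "norm (v (j + 3)) \<le> 36864 * ?r j" using x2 by simp
  qed
  then have "summable (\<lambda>j. v (j + 3))"
    by (rule summable_comparison_test_ev) (intro summable_mult r)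
  then have v: "summable v" by (rule summable_iff_shift[THEN iffD1])
  have "summable (\<lambda>n. real n * (g n)\<^sup>2)"
  proof (rule summable_of_dyadic_blocks)
    show "summable (\<lambda>j. 2 * v j)" by (intro summable_mult v)
    fix j assume j: "j \<ge> Suc n1"
    have "(\<Sum>n\<in>{2 ^ j..<2 ^ Suc j}. real n * (g n)\<^sup>2) \<le> (\<Sum>n\<in>{2 ^ j..<2 ^ Suc j::nat}. 2 ^ Suc j * (g (2 ^ j))\<^sup>2)"
    proof (rule sum_mono)
      fix n :: nat assume n: "n \<in> {2 ^ j..<2 ^ Suc j}"
      then have "real n \<le> real (2 ^ Suc j)" by (intro of_nat_mono) simp
      then have "real n \<le> 2 ^ Suc j" by (simp only: of_nat_power of_nat_numeral)
      moreover have "g n \<le> g (2 ^ j)" using n by (intro g_mono big j) simp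
      moreover have "0 \<le> g n" using n big[OF j] by (intro g_nonneg) (metis atLeastLessThan_iff order_trans)
      ultimately show "real n * (g n)\<^sup>2 \<le> 2 ^ Suc j * (g (2 ^ j))\<^sup>2"
        by (intro mult_mono power_mono) auto
    qed
    also have "\<dots> = 2 * v j" by (simp add: v_def power_mult_distrib power2_eq_square)
    finally show "(\<Sum>n\<in>{2 ^ j..<2 ^ Suc j}. real n * (g n)\<^sup>2) \<le> 2 * v j" .
  qed (simp_all add: v_def)
  then have "summable (\<lambda>n. real (Suc n) * (g (Suc n))\<^sup>2)" by (subst summable_Suc_iff)
  then show False using div by (simp add: g_def)
qed

lemma AE_F2_pairs:
  assumes pos: "\<And>n. n \<ge> 1 \<Longrightarrow> \<phi> n > 0" and mono: "mono_on {1..} \<phi>"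
    and lim: "filterlim (\<lambda>n. \<phi> (Suc n)) at_top sequentially"
    and div: "\<not> summable (\<lambda>n. real (Suc n) * (ln (\<phi> (Suc n)) / \<phi> (Suc n))\<^sup>2)"
  shows "AE x in cyl_law 0. x \<in> F2 \<phi>"
proof -
  \<comment> \<open>Block \<open>j\<close> follows 4 (2^j - 1) digits and has 4 * 2^j digits itself,
    so it ends before index 2^(j + 3).\<close>
  define y where "y j = \<phi> (2 ^ (j + 3))" for j
  \<comment> \<open>The maximum with 0 covers levels below 1, whose logarithm is negative.\<close>
  define q where "q j = max 0 (ln (y j) / (12 * y j))" for j
  define A where "A j = pair_block (2 ^ j) (y j) \<inter> (gauss_map ^^ (2 * 2 ^ j)) -` pair_block (2 ^ j) (y j)" for j
  define r where "r j = (2 ^ j * q j / (1 + 2 ^ j * q j))\<^sup>2" for j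
  have y: "y j > 0" for j unfolding y_def by (rule pos) simp
  have "\<not> summable r"
    unfolding r_def by (rule dyadic_not_summable[OF mono lim div]) (simp add: q_def y_def)
  moreover have "r j \<le> pr t (A j)" if t: "t \<in> {0..1}" for t j
  proof -
    have "q j \<le> pr u (pair_ge (y j))" if "u \<in> {0..1}" for u
      unfolding q_def using pr_pair_ge_ge[OF that y] by (intro max.boundedI) auto
    then show ?thesis
      using pr_double_block_ge[OF t, of "q j" "y j" "2 ^ j"] by (simp add: A_def r_def q_def)
  qed
  moreover have "digit_determined (4 * 2 ^ j) (A j)" for j
    unfolding A_def by (rule double_block_determined)
  moreover have "0 \<le> r j" for j by (simp add: r_def)
  ultimately have "AE x in cyl_law 0. \<exists>\<^sub>\<infinity>j. (gauss_map ^^ (\<Sum>i<j. 4 * 2 ^ i)) x \<in> A j"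
    by (intro conditional_borel_cantelli[of "\<lambda>j. 4 * 2 ^ j" A r]) auto
  with AE_irrational[of 0] show ?thesis
  proof eventually_elim
    fix x assume x: "x \<in> {0<..<1} - \<rat>"
      and inf: "\<exists>\<^sub>\<infinity>j. (gauss_map ^^ (\<Sum>i<j. 4 * 2 ^ i)) x \<in> A j"
    have "\<exists>n\<ge>m. \<exists>k<n. \<exists>l<n. k \<noteq> l \<and> (gauss_map ^^ k) x \<in> pair_ge (\<phi> n) \<and>
        (gauss_map ^^ l) x \<in> pair_ge (\<phi> n)" for m
    proof -
      from inf obtain j where j: "j \<ge> m" "(gauss_map ^^ (\<Sum>i<j. 4 * 2 ^ i)) x \<in> A j"
        unfolding INFM_nat_le by blast
      define M where "M = (\<Sum>i<j. 4 * 2 ^ i :: nat)"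
      have "(\<Sum>i<j. 2 ^ i :: nat) = 2 ^ j - 1" by (induction j) auto
      then have M: "M < 4 * 2 ^ j" unfolding M_def by (simp add: sum_distrib_left[symmetric] diff_mult_distrib2)
      obtain i i' where i: "i < 2 ^ j" "i' < 2 ^ j"
        "(gauss_map ^^ (2 * i)) ((gauss_map ^^ M) x) \<in> pair_ge (y j)"
        "(gauss_map ^^ (2 * i')) ((gauss_map ^^ (2 * 2 ^ j)) ((gauss_map ^^ M) x)) \<in> pair_ge (y j)"
        using j(2) unfolding A_def pair_block_def M_def[symmetric] by blast
      \<comment> \<open>One position from each half of the block, so \<open>k < l\<close>; moreover
        \<open>l\<close> is below 2 * 2^j + 2 * 2^j + 4 * 2^j = 2^(j + 3).\<close>
      define k l where "k = 2 * i + M" and "l = 2 * i' + (2 * 2 ^ j + M)"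
      have "(gauss_map ^^ k) x \<in> pair_ge (\<phi> (2 ^ (j + 3)))" "(gauss_map ^^ l) x \<in> pair_ge (\<phi> (2 ^ (j + 3)))"
        using i(3,4) unfolding k_def l_def funpow_add o_apply y_def by blast+
      moreover have "k < l" "l < 2 ^ (j + 3)" using i(1,2) M by (simp_all add: k_def l_def power_add)
      moreover have "m \<le> 2 ^ (j + 3)" using j(1) less_exp[of "j + 3"] by linarith
      ultimately show ?thesis by (metis less_trans nat_neq_iff)
    qed
    then show "x \<in> F2 \<phi>" using x unfolding F2_iff INFM_nat_le by blast
  qed
qed

theorem theorem1p4:
  fixes \<phi> :: "nat \<Rightarrow> real"
  assumes pos: "\<And>n. n \<ge> 1 \<Longrightarrow> \<phi> n > 0"
    and mono: "mono_on {1..} \<phi>"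
  defines "s \<equiv> \<lambda>n. (\<phi> n + real n * (ln (\<phi> n))\<^sup>2) / (\<phi> n)\<^sup>2"
  shows "F2 \<phi> \<in> sets lebesgue \<and>
    (summable (\<lambda>n. s (n + 1)) \<longrightarrow> emeasure lebesgue (F2 \<phi>) = 0) \<and>
    (\<not> summable (\<lambda>n. s (n + 1)) \<longrightarrow> emeasure lebesgue (F2 \<phi>) = 1)"
proof (intro conjI impI)
  show "F2 \<phi> \<in> sets lebesgue" using F2_sets[of \<phi>] by (simp add: sets_completionI_sets)
next
  assume "summable (\<lambda>n. s (n + 1))"
  then show "emeasure lebesgue (F2 \<phi>) = 0"
    unfolding emeasure_lebesgue_F2 s_def Suc_eq_plus1[symmetric] by (intro F2_null pos mono)
next
  assume div: "\<not> summable (\<lambda>n. s (n + 1))"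
  have "AE x in cyl_law 0. x \<in> F2 \<phi>"
  proof (cases "summable (\<lambda>n. 1 / \<phi> (Suc n))")
    case False
    then show ?thesis by (intro AE_F2_digits pos)
  next
    case True
    have lim: "filterlim (\<lambda>n. \<phi> (Suc n)) at_top sequentially"
      using True pos by (intro filterlim_at_top_of_summable_inverse) auto
    \<comment> \<open>Removing the convergent series of 1 / \<phi> leaves the logarithmic part
      divergent.\<close>
    have "s (n + 1) = 1 / \<phi> (Suc n) + real (Suc n) * (ln (\<phi> (Suc n)) / \<phi> (Suc n))\<^sup>2" for n
      using pos[of "Suc n"] by (simp add: s_def add_divide_distrib power_divide power2_eq_square)
    then have "\<not> summable (\<lambda>n. real (Suc n) * (ln (\<phi> (Suc n)) / \<phi> (Suc n))\<^sup>2)"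
      using div summable_add[OF True] by auto
    then show ?thesis by (intro AE_F2_pairs pos mono lim)
  qed
  then have "emeasure (cyl_law 0) (F2 \<phi>) = emeasure (cyl_law 0) UNIV"
    using F2_sets[of \<phi>] by (intro emeasure_eq_AE) auto
  then show "emeasure lebesgue (F2 \<phi>) = 1"
    unfolding emeasure_lebesgue_F2 by (simp add: emeasure_cyl_law_UNIV)
qed

end
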